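(* Let PBE-CFR be the algorithm described in the context, run on a finite two-player imperfect-information extensive-form game $G$ with node set $H$ and a number of timesteps $T$, and let $A_{max}$ be the largest action set across all players' information sets. Then the worst-case space complexity of PBE-CFR is $O(|H|\cdot|A_{max}|^2)$ and its worst-case time complexity is $O(T\cdot|H|\cdot|A_{max}|^2)$.
   Context: **Game.** A finite two-player extensive-form game consists of: a finite rooted tree with node set $H$ (nodes are histories, the root is $\emptyset$), leaves $Z\subset H$, decision nodes $D=H\setminus Z$; a map $V:D\to\{0,1,2\}$ assigning a player to each decision node ($0$ is Nature); for $j\in\{1,2\}$ a partition $\mathcal I_j$ of $V^{-1}(j)$ into information sets (with perfect recall), each $I\in\mathcal I_j$ having a finite action set $A_j(I)$ (the child of $h\in I$ via $a$ is $ha$); for each chance node $h$ a set $X(h)$ of possible outcomes with a probability distribution $P(\cdot\mid h)$ (child $hx$); and a utility vector $u(z)=(u_1(z),u_2(z))$ at each $z\in Z$. $I(h)$ is the information set containing $h$. A strategy profile $\bm\sigma$ gives a probability distribution $\bm\sigma(I)(\cdot)$ on $A_j(I)$ for each $I\in\mathcal I_j$, $j\in\{1,2\}$. The reach probability $r(h,\bm\sigma)$ is the product of all players' and Nature's probabilities on the path from the root to $h$, and $r(I,\bm\sigma)=\sum_{h\in I}r(h,\bm\sigma)$. Beliefs $\mu$ assign numbers $\mu(h\mid I)$ to the nodes $h$ of each player information set $I$. **PBE-CFR$(G,T)$.** For every information set $I$ of each player $j\in\{1,2\}$ initialize: $\bm\sigma^1(I)(a)=1/|A_j(I)|$, $R(I,a)=0$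 and $S_I(a)=0$ for all $a\in A_j(I)$; $\mu^1(h\mid I)=1/|I|$ and $U^E(h)=0$ for all $h\in I$; $U^B_j(I)=0$. For $t=1,\dots,T$: call Traverse$(\emptyset,(1,1,1))$ with current $\bm\sigma^t,\mu^t$ (this also produces $\bm\sigma^{t+1}$), then set $\mu^{t+1}=$ UpdateBeliefs$(\bm\sigma^{t+1})$. Finally let $\bm\sigma^*(I)$ be the average of $\bm\sigma^1(I),\dots,\bm\sigma^T(I)$ for every $I$, let $\mu^*=$ UpdateBeliefs$(\bm\sigma^* )$, and return $(\bm\sigma^*,\mu^* )$. **Traverse$(h,\bm r)$**, where $\bm r=(r_0,r_1,r_2)$ is a vector of player reach probabilities. Let $j=V(h)$. If $h$ is a leaf, return $u(h)$. If $j=0$: start with $u^E=\vec 0$; for each $x\in X(h)$ let $\bm r'$ be $\bm r$ with $r_0$ replaced by $r_0P(x\mid h)$, set $U^E(hx)\gets$ Traverse$(hx,\bm r')$ and $u^E\gets u^E+P(x\mid h)U^E(hx)$; then set $U^E(h)=u^E$ and return it. Otherwise let $I=I(h)$; set $U^E_j(ha)\gets0$ and $U^B_j(I,a)\gets0$ for all $a\in A_j(I)$. For each $a\in A_j(I)$: let $\bm r'$ be $\bm r$ with $r_j$ replaced by $r_j\,\bm\sigma^t(I)(a)$; set, in order, $U^E(ha)\gets$ Traverse$(ha,\bm r')$; $U^E(h)\gets U^E(h)+\bm\sigma^t(I)(a)U^E(ha)$; $U^B_j(I,a)\gets U^B_j(I,a)+\mu^t(h\mid I)U^E_j(ha)$;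 $U^B_j(I)\gets U^B_j(I)+\bm\sigma^t(I)(a)U^B_j(I,a)$. Then for each $a\in A_j(I)$ set $R(I,a)\gets R(I,a)+U^B_j(I,a)-U^B_j(I)$. Update $\bm\sigma^{t+1}(I)$ from the values $R(I,\cdot)$ by regret matching (probabilities proportional to $\max(0,R(I,a))$, uniform if all of these are zero), set $S_I(a)\gets S_I(a)+\bm\sigma^{t+1}(I)(a)$ for all $a$, and return $U^E(h)$. **UpdateBeliefs$(\bm\sigma)$.** First construct a set $\mathcal P$ of relations, initially empty: for every player information set $I$ and every $h\in I$, start with $B=W=\emptyset$; for each action $a$ at $I$, if $\bm\sigma(I)(a)>0$ add $h\sim ha$ to $\mathcal P$ and $ha$ to $B$, otherwise add $h\prec ha$ to $\mathcal P$ and $ha$ to $W$; then add $h_1\prec h_2$ to $\mathcal P$ for all $(h_1,h_2)\in B\times W$. For every chance node $h$ and $x\in X(h)$ add $h\sim hx$ to $\mathcal P$. Then for every player information set $I$ compute $r(I,\bm\sigma)=\sum_{h\in I}r(h,\bm\sigma)$. If $r(I,\bm\sigma)=0$: start with $C=\emptyset$; loop over all pairs $(h_1,h_2)\in\binom I2$, adding $h_1$ to $C$ if the pair is related in $\mathcal P$ with $h_1\prec h_2$; then for each $h\in I$ set $\mu(h\mid I)=1/|C|$ if $h\in C$ and $\mu(h\mid I)=0$ otherwise. If $r(I,\bm\sigma)>0$, set $\mu(h\mid I)=r(h,\bm\sigma)/r(I,\bm\sigma)$ for $h\in I$. Return $\mu$. **Cost model.** Elementary operations, stored numbers and stored relations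 each count as unit cost.
   Formalization: The loop over all pairs of binom(I,2) in UpdateBeliefs is run over the stored relations h1 ≺ h2 with h1 in I (same set C); charging every pair makes the time bound false (one unreached information set of size n, A_max = 2, |H| = 3n+3). T ≥ 1 and some player information set are assumed. *)

theory Defs
  imports Complex_Main "HOL-Library.Disjoint_Sets" "HOL-Library.State_Monad"
begin

section \<open>Finite two-player extensive-form games\<close>

text \<open>
  A node is the list of moves (actions or chance outcomes) leading to it, so the root is \<open>[]\<close> and
  the child of \<open>h\<close> via \<open>a\<close> is \<open>h @ [a]\<close>.  Since the information sets of both players are nonempty and
  pairwise disjoint, the player index of \<open>A\<^sub>j(I)\<close> is redundant and is dropped.
\<close>

record 'a game =
  hist :: "'a list set"
  player :: "'a list \<Rightarrow> nat"
  infosets :: "nat \<Rightarrow> 'a list set set"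
  acts :: "'a list set \<Rightarrow> 'a set"
  prob :: "'a list \<Rightarrow> 'a \<Rightarrow> real"
  util :: "'a list \<Rightarrow> nat \<Rightarrow> real"

definition children :: "'a game \<Rightarrow> 'a list \<Rightarrow> 'a set" where
  "children G h = {a. h @ [a] \<in> hist G}"

definition leaves :: "'a game \<Rightarrow> 'a list set" where
  "leaves G = {h \<in> hist G. children G h = {}}"

definition decision_nodes :: "'a game \<Rightarrow> 'a list set" where
  "decision_nodes G = hist G - leaves G"

definition all_infosets :: "'a game \<Rightarrow> 'a list set set" where
  "all_infosets G = infosets G 1 \<union> infosets G 2"

definition infoset_of :: "'a game \<Rightarrow> 'a list \<Rightarrow> 'a list set" where
  "infoset_of G h = (THE I. I \<in> infosets G (player G h) \<and> h \<in> I)"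

text \<open>The information sets player \<open>j\<close> has passed on the way to \<open>h\<close>, with the actions taken there.\<close>

definition experience :: "'a game \<Rightarrow> nat \<Rightarrow> 'a list \<Rightarrow> ('a list set \<times> 'a) list" where
  "experience G j h =
     [(infoset_of G (take k h), h ! k). k \<leftarrow> [0..<length h], player G (take k h) = j]"

definition max_acts :: "'a game \<Rightarrow> nat" where
  "max_acts G = Max ((\<lambda>I. card (acts G I)) ` all_infosets G)"

locale finite_game =
  fixes G :: "'a game"
  assumes finite_hist: "finite (hist G)"
    and root: "[] \<in> hist G"
    and prefix_closed: "h @ [a] \<in> hist G \<Longrightarrow> h \<in> hist G"
    and player_range: "h \<in> decision_nodes G \<Longrightarrow> player G h \<in> {0, 1, 2}"
    and infosets_partition:
      "j \<in> {1, 2} \<Longrightarrow> partition_on {h \<in> decision_nodes G. player G h = j} (infosets G j)"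
    and acts_children:
      "j \<in> {1, 2} \<Longrightarrow> I \<in> infosets G j \<Longrightarrow> h \<in> I \<Longrightarrow> children G h = acts G I"
    and perfect_recall:
      "j \<in> {1, 2} \<Longrightarrow> I \<in> infosets G j \<Longrightarrow> h \<in> I \<Longrightarrow> h' \<in> I
        \<Longrightarrow> experience G j h = experience G j h'"
    and prob_nonneg:
      "h \<in> decision_nodes G \<Longrightarrow> player G h = 0 \<Longrightarrow> x \<in> children G h \<Longrightarrow> prob G h x \<ge> 0"
    and prob_sum:
      "h \<in> decision_nodes G \<Longrightarrow> player G h = 0 \<Longrightarrow> (\<Sum>x\<in>children G h. prob G h x) = 1"


section \<open>Unit-cost machine\<close>

text \<open>
  The memory consists of addressable cells.  A cell holds one real number or records one item (a
  relation, the membership of a node in a set, a pointer or a loop position); only occupied cells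
  count for space.  The names of the cells follow the pseudocode, except for:

  \<^item> \<open>StratSum\<close>: running sum of \<open>\<sigma>\<^sup>1(I)(a), \<dots>, \<sigma>\<^sup>t(I)(a)\<close>, from which the average strategy
    \<open>Avg\<close> is computed (the values \<open>S\<^sub>I(a)\<close> collect \<open>\<sigma>\<^sup>t\<^sup>+\<^sup>1\<close> once per visited node of \<open>I\<close>, so they do
    not sum up to that average);
  \<^item> \<open>Arg h i\<close>, \<open>UAcc h i\<close>, \<open>Frame h k\<close>: the argument \<open>r\<^sub>i\<close>, the local vector \<open>u\<^sup>E\<close> and the
    remaining locals (current node, player, information set, loop position, temporaries, return
    address and value) of the activation of a recursive procedure at \<open>h\<close>;
  \<^item> \<open>Ctrl k\<close>: loop positions and temporaries of the non-recursive parts;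
  \<^item> \<open>InNode\<close> to \<open>InUtil\<close>: the input, i.e. the game.
\<close>

datatype 'a cell =
    Strat "'a list set" 'a
  | NextStrat "'a list set" 'a
  | StratSum "'a list set" 'a
  | Avg "'a list set" 'a
  | Regret "'a list set" 'a
  | RegretSum "'a list set"
  | S "'a list set" 'a
  | Belief "'a list"
  | UE "'a list" nat
  | UBact "'a list set" 'a
  | UB "'a list set"
  | Reach "'a list"
  | ReachI "'a list set"
  | Prec "'a list" "'a list"
  | Sim "'a list" "'a list"
  | InB "'a list" "'a list"
  | InW "'a list" "'a list"
  | InC "'a list"
  | CardC
  | Arg "'a list" nat
  | UAcc "'a list" nat
  | Frame "'a list" nat
  | Ctrl nat
  | InNode "'a list"
  | InPlayer "'a list"
  | InInfoset "'a list"
  | InAct "'a list set" 'a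
  | InProb "'a list" 'a
  | InUtil "'a list" nat

record 'a machine =
  content :: "'a cell \<Rightarrow> real"
  occupied :: "'a cell set"
  time :: nat
  peak :: nat

type_synonym ('a, 'r) prog = "('a machine, 'r) state"

definition tick :: "('a, unit) prog" where
  "tick = State_Monad.update (\<lambda>s. s\<lparr>time := time s + 1\<rparr>)"

text \<open>One arithmetic operation or comparison.\<close>

definition op :: "'r \<Rightarrow> ('a, 'r) prog" where
  "op x = do { tick; State_Monad.return x }"

definition load :: "'a cell \<Rightarrow> ('a, real) prog" where
  "load c = do { tick; s \<leftarrow> State_Monad.get; State_Monad.return (content s c) }"

definition occupied_test :: "'a cell \<Rightarrow> ('a, bool) prog" where
  "occupied_test c = do { tick; s \<leftarrow> State_Monad.get; State_Monad.return (c \<in> occupied s) }"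

definition mark :: "'a cell \<Rightarrow> ('a, unit) prog" where
  "mark c = do {
     tick;
     State_Monad.update (\<lambda>s. s\<lparr>occupied := insert c (occupied s),
                               peak := max (peak s) (card (insert c (occupied s)))\<rparr>) }"

definition store :: "'a cell \<Rightarrow> real \<Rightarrow> ('a, unit) prog" where
  "store c v = do { mark c; State_Monad.update (\<lambda>s. s\<lparr>content := (content s)(c := v)\<rparr>) }"

definition release :: "'a cell \<Rightarrow> ('a, unit) prog" where
  "release c = do { tick; State_Monad.update (\<lambda>s. s\<lparr>occupied := occupied s - {c}\<rparr>) }"

definition add_to :: "'a cell \<Rightarrow> real \<Rightarrow> ('a, unit) prog" where
  "add_to c v = do { x \<leftarrow> load c; y \<leftarrow> op (x + v); store c y }"

primrec foreach :: "'b list \<Rightarrow> ('b \<Rightarrow> ('a, unit) prog) \<Rightarrow> ('a, unit) prog" where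
  "foreach [] f = tick"
| "foreach (x # xs) f = do { tick; f x; foreach xs f }"

text \<open>Loops over a set run through it in some fixed order.\<close>

definition enum :: "'b set \<Rightarrow> 'b list" where
  "enum A = (SOME xs. set xs = A \<and> distinct xs)"

lemma enum: "finite A \<Longrightarrow> set (enum A) = A \<and> distinct (enum A)"
  unfolding enum_def by (rule someI_ex) (rule finite_distinct_list)

text \<open>
  Enumeration of the stored items \<open>x\<close> with a given kind of cell \<open>f x\<close>; the loop over the result pays
  for each of them.
\<close>

definition stored :: "('b \<Rightarrow> 'a cell) \<Rightarrow> ('a, 'b list) prog" where
  "stored f = do { tick; s \<leftarrow> State_Monad.get; State_Monad.return (enum {x. f x \<in> occupied s}) }"

definition clear :: "('b \<Rightarrow> 'a cell) \<Rightarrow> ('a, unit) prog" where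
  "clear f = do { xs \<leftarrow> stored f; foreach xs (\<lambda>x. release (f x)) }"

definition size_of :: "'b set \<Rightarrow> ('a, real) prog" where
  "size_of A = do { foreach (enum A) (\<lambda>_. tick); State_Monad.return (real (card A)) }"

definition frame_size :: nat where
  "frame_size = 16"

definition enter :: "'a list \<Rightarrow> ('a, unit) prog" where
  "enter h = foreach [0..<frame_size] (\<lambda>k. mark (Frame h k))"

definition leave :: "'a list \<Rightarrow> ('a, unit) prog" where
  "leave h = foreach [0..<frame_size] (\<lambda>k. release (Frame h k))"

lemma foreach_cong [fundef_cong]:
  assumes "xs = ys" "\<And>x. x \<in> set ys \<Longrightarrow> f x = g x"
  shows "foreach xs f = foreach ys g"
  using assms(2) unfolding assms(1) by (induction ys) auto

lemma bind_state_cong [fundef_cong]: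
  fixes m m' :: "('s, 'x) state"
  assumes "m = m'" "\<And>x. f x = f' x"
  shows "State_Monad.bind m f = State_Monad.bind m' f'"
proof -
  have "f = f'" using assms(2) by (rule ext)
  then show ?thesis using assms(1) by simp
qed


section \<open>The algorithm\<close>

context finite_game
begin

lemma child_measure:
  assumes "h @ [a] \<in> hist G"
  shows "card {g \<in> hist G. length g > Suc (length h)} < card {g \<in> hist G. length g > length h}"
proof (rule psubset_card_mono)
  show "finite {g \<in> hist G. length g > length h}"
    using finite_hist by simp
  have "h @ [a] \<in> {g \<in> hist G. length g > length h}"
    and "h @ [a] \<notin> {g \<in> hist G. length g > Suc (length h)}"
    using assms by auto
  then show "{g \<in> hist G. length g > Suc (length h)} \<subset> {g \<in> hist G. length g > length h}"
    by (metis (mono_tags, lifting) Suc_lessD mem_Collect_eq psubsetI subsetI)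
qed

lemma finite_children: "finite (children G h)"
proof -
  have "(\<lambda>a. h @ [a]) ` children G h \<subseteq> hist G"
    by (auto simp: children_def)
  moreover have "inj_on (\<lambda>a. h @ [a]) (children G h)"
    by (auto simp: inj_on_def)
  ultimately show ?thesis
    using finite_hist finite_imageD finite_subset by metis
qed

lemma set_enum_children: "set (enum (children G h)) = children G h"
  using enum finite_children by blast

lemma infoset_of:
  assumes "children G h \<noteq> {}" "player G h \<noteq> 0"
  shows "infoset_of G h \<in> infosets G (player G h)" "h \<in> infoset_of G h" "player G h \<in> {1, 2}"
proof -
  obtain a where "h @ [a] \<in> hist G"
    using assms(1) by (auto simp: children_def)
  then have h: "h \<in> decision_nodes G"
    using prefix_closed assms(1) by (auto simp: decision_nodes_def leaves_def)
  show j: "player G h \<in> {1, 2}"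
    using player_range[OF h] assms(2) by auto
  have "\<exists>!I. I \<in> infosets G (player G h) \<and> h \<in> I"
    using infosets_partition[OF j] h
    unfolding partition_on_def disjoint_def by blast
  from theI'[OF this]
  show "infoset_of G h \<in> infosets G (player G h)" "h \<in> infoset_of G h"
    unfolding infoset_of_def by auto
qed

lemma acts_infoset_of:
  "children G h \<noteq> {} \<Longrightarrow> player G h \<noteq> 0 \<Longrightarrow> acts G (infoset_of G h) = children G h"
  using infoset_of acts_children by metis

lemma enum_child_measure:
  "a \<in> set (enum (children G h)) \<Longrightarrow>
    card {g \<in> hist G. length g > Suc (length h)} < card {g \<in> hist G. length g > length h}"
  using child_measure unfolding set_enum_children by (auto simp: children_def)

definition update_next_strategy :: "'a list set \<Rightarrow> ('a, unit) prog" where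
  "update_next_strategy I = do {
     store (RegretSum I) 0;
     foreach (enum (acts G I)) (\<lambda>a. do {
       x \<leftarrow> load (Regret I a);
       y \<leftarrow> op (max 0 x);
       add_to (RegretSum I) y });
     z \<leftarrow> load (RegretSum I);
     n \<leftarrow> size_of (acts G I);
     foreach (enum (acts G I)) (\<lambda>a. do {
       tick;
       if z = 0 then do {
         q \<leftarrow> op (1 / n);
         store (NextStrat I a) q }
       else do {
         x \<leftarrow> load (Regret I a);
         y \<leftarrow> op (max 0 x);
         q \<leftarrow> op (y / z);
         store (NextStrat I a) q } });
     release (RegretSum I) }"

function traverse :: "'a list \<Rightarrow> (nat \<Rightarrow> real) \<Rightarrow> ('a, nat \<Rightarrow> real) prog" where
  "traverse h r = do {
     enter h;
     foreach [0, 1, 2] (\<lambda>i. store (Arg h i) (r i));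
     tick;
     v \<leftarrow>
      (if children G h = {} then do {
         v1 \<leftarrow> load (InUtil h 1);
         v2 \<leftarrow> load (InUtil h 2);
         State_Monad.return (\<lambda>i. if i = 1 then v1 else v2) }
       else do {
         tick;
         if player G h = 0 then do {
           foreach [1, 2] (\<lambda>i. store (UAcc h i) 0);
           foreach (enum (children G h)) (\<lambda>x. do {
             p \<leftarrow> load (InProb h x);
             r0 \<leftarrow> load (Arg h 0);
             r0' \<leftarrow> op (r0 * p);
             v \<leftarrow> traverse (h @ [x]) (r(0 := r0'));
             foreach [1, 2] (\<lambda>i. store (UE (h @ [x]) i) (v i));
             foreach [1, 2] (\<lambda>i. do {
               y \<leftarrow> load (UE (h @ [x]) i);
               w \<leftarrow> op (p * y);
               add_to (UAcc h i) w }) });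
           foreach [1, 2] (\<lambda>i. do { y \<leftarrow> load (UAcc h i); store (UE h i) y; release (UAcc h i) });
           v1 \<leftarrow> load (UE h 1);
           v2 \<leftarrow> load (UE h 2);
           State_Monad.return (\<lambda>i. if i = 1 then v1 else v2) }
         else let j = player G h; I = infoset_of G h in do {
           tick;
           foreach (enum (acts G I)) (\<lambda>a. do {
             store (UE (h @ [a]) j) 0;
             store (UBact I a) 0 });
           foreach (enum (acts G I)) (\<lambda>a. do {
             p \<leftarrow> load (Strat I a);
             rj \<leftarrow> load (Arg h j);
             rj' \<leftarrow> op (rj * p);
             v \<leftarrow> traverse (h @ [a]) (r(j := rj'));
             foreach [1, 2] (\<lambda>i. store (UE (h @ [a]) i) (v i));
             foreach [1, 2] (\<lambda>i. do {
               y \<leftarrow> load (UE (h @ [a]) i);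
               w \<leftarrow> op (p * y);
               add_to (UE h i) w });
             m \<leftarrow> load (Belief h);
             y \<leftarrow> load (UE (h @ [a]) j);
             w \<leftarrow> op (m * y);
             add_to (UBact I a) w;
             b \<leftarrow> load (UBact I a);
             w' \<leftarrow> op (p * b);
             add_to (UB I) w' });
           foreach (enum (acts G I)) (\<lambda>a. do {
             x \<leftarrow> load (UBact I a);
             y \<leftarrow> load (UB I);
             d \<leftarrow> op (x - y);
             add_to (Regret I a) d });
           update_next_strategy I;
           foreach (enum (acts G I)) (\<lambda>a. do {
             q \<leftarrow> load (NextStrat I a);
             add_to (S I a) q });
           v1 \<leftarrow> load (UE h 1);
           v2 \<leftarrow> load (UE h 2);
           State_Monad.return (\<lambda>i. if i = 1 then v1 else v2) } });
     foreach [0, 1, 2] (\<lambda>i. release (Arg h i));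
     leave h;
     State_Monad.return v }"
  by pat_completeness auto
termination
  by (relation "measure (\<lambda>(h, _). card {g \<in> hist G. length g > length h})")
    (auto simp: acts_infoset_of enum_child_measure)

text \<open>
  \<open>UpdateBeliefs\<close> is run both on \<open>\<sigma>\<^sup>t\<^sup>+\<^sup>1\<close> and on the average strategy; its argument \<open>sg\<close> tells in which
  cells the strategy is stored.
\<close>

definition add_relations :: "('a list set \<Rightarrow> 'a \<Rightarrow> 'a cell) \<Rightarrow> ('a, unit) prog" where
  "add_relations sg = do {
     foreach (enum (all_infosets G)) (\<lambda>I. foreach (enum I) (\<lambda>h. do {
       foreach (enum (acts G I)) (\<lambda>a. do {
         p \<leftarrow> load (sg I a);
         tick;
         if p > 0 then do { mark (Sim h (h @ [a])); mark (InB h (h @ [a])) }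
         else do { mark (Prec h (h @ [a])); mark (InW h (h @ [a])) } });
       B \<leftarrow> stored (InB h);
       W \<leftarrow> stored (InW h);
       foreach B (\<lambda>h1. foreach W (\<lambda>h2. mark (Prec h1 h2)));
       clear (InB h);
       clear (InW h) }));
     foreach (enum {h \<in> decision_nodes G. player G h = 0}) (\<lambda>h.
       foreach (enum (children G h)) (\<lambda>x. mark (Sim h (h @ [x])))) }"

text \<open>
  The reach probabilities of all nodes are computed in one pass from the root, each from that of
  the parent.
\<close>

function reach_below :: "('a list set \<Rightarrow> 'a \<Rightarrow> 'a cell) \<Rightarrow> 'a list \<Rightarrow> ('a, unit) prog" where
  "reach_below sg h = do {
     enter h;
     foreach (enum (children G h)) (\<lambda>a. do {
       tick;
       p \<leftarrow> load (if player G h = 0 then InProb h a else sg (infoset_of G h) a);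
       q \<leftarrow> load (Reach h);
       w \<leftarrow> op (q * p);
       store (Reach (h @ [a])) w;
       reach_below sg (h @ [a]) });
     leave h }"
  by pat_completeness auto
termination
  by (relation "measure (\<lambda>(_, h). card {g \<in> hist G. length g > length h})")
    (auto simp: enum_child_measure)

definition compute_reach :: "('a list set \<Rightarrow> 'a \<Rightarrow> 'a cell) \<Rightarrow> ('a, unit) prog" where
  "compute_reach sg = do { store (Reach []) 1; reach_below sg [] }"

text \<open>
  The nodes \<open>h1\<close> of a pair \<open>h1 \<prec> h2\<close> in \<open>I\<close>.  The pairs are found by going through the stored relations
  \<open>h1 \<prec> h2\<close> of each \<open>h1 \<in> I\<close>, so that a pair that is not related costs nothing.  (Testing all pairs of
  elements of \<open>I\<close> one by one takes quadratic time in \<open>card I\<close>, which is not bounded by a constant times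
  \<open>card (hist G) * (max_acts G)\<^sup>2\<close>.)  The lemma \<open>collect_C_eq_pair_loop\<close> below shows that this gives the
  same set as the loop over all pairs.
\<close>

definition collect_C :: "'a list set \<Rightarrow> ('a, unit) prog" where
  "collect_C I = foreach (enum I) (\<lambda>h1. do {
     hs \<leftarrow> stored (Prec h1);
     foreach hs (\<lambda>h2. do {
       tick;
       if h2 \<in> I \<and> h2 \<noteq> h1 then mark (InC h1) else State_Monad.return () }) })"

definition pair_loop_C :: "'a list set \<Rightarrow> ('a, unit) prog" where
  "pair_loop_C I = foreach (enum I) (\<lambda>h1. foreach (enum (I - {h1})) (\<lambda>h2. do {
     b \<leftarrow> occupied_test (Prec h1 h2);
     if b then mark (InC h1) else State_Monad.return () }))"

lemma foreach_marks:
  fixes R :: "('a list \<times> 'a list) set"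
  assumes step: "\<And>x s. x \<in> set xs \<Longrightarrow> {(h, h'). Prec h h' \<in> occupied s} = R \<Longrightarrow>
      content (snd (run_state (f x) s)) = content s \<and>
      occupied (snd (run_state (f x) s)) = occupied s \<union> InC ` F x"
    and "{(h, h'). Prec h h' \<in> occupied s} = R"
  shows "content (snd (run_state (foreach xs f) s)) = content s \<and>
      occupied (snd (run_state (foreach xs f) s)) = occupied s \<union> InC ` (\<Union>x\<in>set xs. F x)"
  using assms
proof (induction xs arbitrary: s)
  case Nil
  then show ?case by (simp add: tick_def State_Monad.update_def State_Monad.get_def State_Monad.set_def)
next
  case (Cons x xs)
  define s1 where "s1 = snd (run_state tick s)"
  have s1: "content s1 = content s" "occupied s1 = occupied s"
    by (simp_all add: s1_def tick_def State_Monad.update_def State_Monad.get_def State_Monad.set_def)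
  define s2 where "s2 = snd (run_state (f x) s1)"
  have s2: "content s2 = content s" "occupied s2 = occupied s \<union> InC ` F x"
    using Cons.prems(1)[of x s1] Cons.prems(2) s1 by (simp_all add: s2_def)
  have "{(h, h'). Prec h h' \<in> occupied s2} = R"
    using Cons.prems(2) s2(2) by auto
  then have IH: "content (snd (run_state (foreach xs f) s2)) = content s2 \<and>
      occupied (snd (run_state (foreach xs f) s2)) = occupied s2 \<union> InC ` (\<Union>x\<in>set xs. F x)"
    using Cons.prems(1) by (intro Cons.IH) auto
  have "snd (run_state (foreach (x # xs) f) s) = snd (run_state (foreach xs f) s2)"
    by (simp add: s2_def s1_def split: prod.splits)
  then show ?case
    using IH s2 by auto
qed

lemma collect_C_effect:
  assumes "finite I" "finite (occupied s)"
  shows "content (snd (run_state (collect_C I) s)) = content s \<and>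
    occupied (snd (run_state (collect_C I) s)) =
      occupied s \<union> InC ` {h1 \<in> I. \<exists>h2\<in>I. h1 \<noteq> h2 \<and> Prec h1 h2 \<in> occupied s}"
proof -
  define R where "R = {(h, h'). Prec h h' \<in> occupied s}"
  have fin: "finite {h2. (h1, h2) \<in> R}" for h1
    using finite_vimageI[OF assms(2), of "Prec h1"] by (simp add: R_def inj_def vimage_def)
  have *: "content (snd (run_state (collect_C I) s)) = content s \<and>
    occupied (snd (run_state (collect_C I) s)) = occupied s \<union> InC ` (\<Union>h1\<in>set (enum I).
      \<Union>h2\<in>set (enum {h2. (h1, h2) \<in> R}). (if h2 \<in> I \<and> h2 \<noteq> h1 then {h1} else {}))"
    unfolding collect_C_def
  proof (rule foreach_marks[where R = R], goal_cases)
    case (1 h1 t)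
    define t1 where "t1 = snd (run_state tick t)"
    have t1: "content t1 = content t" "occupied t1 = occupied t"
      by (simp_all add: t1_def tick_def State_Monad.update_def State_Monad.get_def State_Monad.set_def)
    have out: "run_state (stored (Prec h1)) t = (enum {h2. (h1, h2) \<in> R}, t1)"
      using 1(2) by (auto simp: stored_def t1_def tick_def State_Monad.update_def
          State_Monad.get_def State_Monad.set_def)
    have R1: "{(h, h'). Prec h h' \<in> occupied t1} = R"
      using 1(2) t1 by simp
    let ?body = "\<lambda>h2. do {
       tick;
       if h2 \<in> I \<and> h2 \<noteq> h1 then mark (InC h1) else State_Monad.return () } :: ('a, unit) prog"
    have "content (snd (run_state (foreach (enum {h2. (h1, h2) \<in> R}) ?body) t1)) = content t1 \<and>
      occupied (snd (run_state (foreach (enum {h2. (h1, h2) \<in> R}) ?body) t1)) = occupied t1 \<union>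
        InC ` (\<Union>h2\<in>set (enum {h2. (h1, h2) \<in> R}). (if h2 \<in> I \<and> h2 \<noteq> h1 then {h1} else {}))"
      by (rule foreach_marks[where R = R])
        (auto simp: R1 tick_def mark_def State_Monad.update_def
          State_Monad.get_def State_Monad.set_def)
    then show ?case
      using t1 by (simp add: out)
  qed (simp add: R_def)
  have "(\<Union>h1\<in>set (enum I). \<Union>h2\<in>set (enum {h2. (h1, h2) \<in> R}).
      (if h2 \<in> I \<and> h2 \<noteq> h1 then {h1} else {})) =
      {h1 \<in> I. \<exists>h2\<in>I. h1 \<noteq> h2 \<and> Prec h1 h2 \<in> occupied s}"
  proof -
    have "set (enum I) = I" "set (enum {h2. (h1, h2) \<in> R}) = {h2. (h1, h2) \<in> R}" for h1
      using enum[OF assms(1)] enum[OF fin] by auto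
    then show ?thesis
      unfolding R_def by (simp add: set_eq_iff) metis
  qed
  with * show ?thesis by simp
qed

lemma pair_loop_C_effect:
  assumes "finite I"
  shows "content (snd (run_state (pair_loop_C I) s)) = content s \<and>
    occupied (snd (run_state (pair_loop_C I) s)) =
      occupied s \<union> InC ` {h1 \<in> I. \<exists>h2\<in>I. h1 \<noteq> h2 \<and> Prec h1 h2 \<in> occupied s}"
proof -
  define R where "R = {(h, h'). Prec h h' \<in> occupied s}"
  have fin: "finite (I - {h1})" for h1
    using assms by simp
  have *: "content (snd (run_state (pair_loop_C I) s)) = content s \<and>
    occupied (snd (run_state (pair_loop_C I) s)) = occupied s \<union> InC ` (\<Union>h1\<in>set (enum I).
      \<Union>h2\<in>set (enum (I - {h1})). (if (h1, h2) \<in> R then {h1} else {}))"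
    unfolding pair_loop_C_def
  proof (rule foreach_marks[where R = R], goal_cases)
    case (1 h1 t)
    show ?case
    proof (rule foreach_marks[where R = R], goal_cases)
      case (1 h2 t)
      then have "(Prec h1 h2 \<in> occupied t) = ((h1, h2) \<in> R)" by auto
      then show ?case
        by (auto simp: occupied_test_def tick_def mark_def State_Monad.update_def
          State_Monad.get_def State_Monad.set_def)
    qed (use 1 in simp)
  qed (simp add: R_def)
  have "(\<Union>h1\<in>set (enum I). \<Union>h2\<in>set (enum (I - {h1})). (if (h1, h2) \<in> R then {h1} else {})) =
      {h1 \<in> I. \<exists>h2\<in>I. h1 \<noteq> h2 \<and> Prec h1 h2 \<in> occupied s}"
  proof -
    have "set (enum I) = I" "set (enum (I - {h1})) = (I - {h1})" for h1
      using enum[OF assms(1)] enum[OF fin] by auto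
    then show ?thesis
      unfolding R_def by (simp add: set_eq_iff) metis
  qed
  with * show ?thesis by simp
qed

lemma collect_C_eq_pair_loop:
  assumes "finite I" "finite (occupied s)"
  shows "content (snd (run_state (collect_C I) s)) = content (snd (run_state (pair_loop_C I) s))"
    and "occupied (snd (run_state (collect_C I) s)) = occupied (snd (run_state (pair_loop_C I) s))"
  using collect_C_effect[OF assms] pair_loop_C_effect[OF assms(1), of s] by auto

definition beliefs_at :: "'a list set \<Rightarrow> ('a, unit) prog" where
  "beliefs_at I = do {
     store (ReachI I) 0;
     foreach (enum I) (\<lambda>h. do { q \<leftarrow> load (Reach h); add_to (ReachI I) q });
     rI \<leftarrow> load (ReachI I);
     tick;
     (if rI = 0 then do {
       collect_C I;
       store CardC 0;
       foreach (enum I) (\<lambda>h. do {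
         b \<leftarrow> occupied_test (InC h);
         if b then add_to CardC 1 else State_Monad.return () });
       n \<leftarrow> load CardC;
       foreach (enum I) (\<lambda>h. do {
         b \<leftarrow> occupied_test (InC h);
         if b then do { m \<leftarrow> op (1 / n); store (Belief h) m } else store (Belief h) 0 });
       clear InC;
       release CardC }
     else foreach (enum I) (\<lambda>h. do {
       q \<leftarrow> load (Reach h);
       m \<leftarrow> op (q / rI);
       store (Belief h) m }));
     release (ReachI I) }"

definition update_beliefs :: "('a list set \<Rightarrow> 'a \<Rightarrow> 'a cell) \<Rightarrow> ('a, unit) prog" where
  "update_beliefs sg = do {
     clear (\<lambda>(h, h'). Prec h h');
     clear (\<lambda>(h, h'). Sim h h');
     add_relations sg;
     compute_reach sg;
     foreach (enum (all_infosets G)) beliefs_at }"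

definition initialize :: "('a, unit) prog" where
  "initialize = do {
     foreach [0..<frame_size] (\<lambda>k. mark (Ctrl k));
     foreach (enum (all_infosets G)) (\<lambda>I. do {
       n \<leftarrow> size_of (acts G I);
       foreach (enum (acts G I)) (\<lambda>a. do {
         p \<leftarrow> op (1 / n);
         store (Strat I a) p;
         store (StratSum I a) 0;
         store (Regret I a) 0;
         store (S I a) 0 });
       k \<leftarrow> size_of I;
       foreach (enum I) (\<lambda>h. do {
         m \<leftarrow> op (1 / k);
         store (Belief h) m;
         foreach [1, 2] (\<lambda>i. store (UE h i) 0) });
       store (UB I) 0 }) }"

definition timestep :: "('a, unit) prog" where
  "timestep = do {
     foreach (enum (all_infosets G)) (\<lambda>I. foreach (enum (acts G I)) (\<lambda>a. do {
       p \<leftarrow> load (Strat I a);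
       add_to (StratSum I a) p }));
     _ \<leftarrow> traverse [] (\<lambda>_. 1);
     foreach (enum (all_infosets G)) (\<lambda>I. foreach (enum (acts G I)) (\<lambda>a. do {
       p \<leftarrow> load (NextStrat I a);
       store (Strat I a) p }));
     update_beliefs Strat }"

text \<open>The returned strategy and beliefs are left in the cells \<open>Avg\<close> and \<open>Belief\<close>.\<close>

definition pbe_cfr :: "nat \<Rightarrow> ('a, unit) prog" where
  "pbe_cfr T = do {
     initialize;
     foreach [0..<T] (\<lambda>_. timestep);
     foreach (enum (all_infosets G)) (\<lambda>I. foreach (enum (acts G I)) (\<lambda>a. do {
       x \<leftarrow> load (StratSum I a);
       q \<leftarrow> op (x / real T);
       store (Avg I a) q }));
     update_beliefs Avg }"

text \<open>Initially the memory contains the game, which is counted as part of the space.\<close>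

definition input_cells :: "'a cell set" where
  "input_cells =
     InNode ` hist G
     \<union> InPlayer ` decision_nodes G
     \<union> InInfoset ` \<Union> (all_infosets G)
     \<union> {InAct I a | I a. I \<in> all_infosets G \<and> a \<in> acts G I}
     \<union> {InProb h x | h x. h \<in> decision_nodes G \<and> player G h = 0 \<and> x \<in> children G h}
     \<union> {InUtil z i | z i. z \<in> leaves G \<and> i \<in> {1, 2}}"

definition input_machine :: "'a machine" where
  "input_machine =
     \<lparr>content = (\<lambda>c. case c of InProb h x \<Rightarrow> prob G h x | InUtil z i \<Rightarrow> util G z i | _ \<Rightarrow> undefined),
      occupied = input_cells, time = 0, peak = card input_cells\<rparr>"

definition pbe_cfr_time :: "nat \<Rightarrow> nat" where
  "pbe_cfr_time T = time (snd (run_state (pbe_cfr T) input_machine))"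

definition pbe_cfr_space :: "nat \<Rightarrow> nat" where
  "pbe_cfr_space T = peak (snd (run_state (pbe_cfr T) input_machine))"

end

end

theory Submission
  imports Defs
begin

text \<open>
  All cells that the algorithm ever occupies lie in a fixed set, and the only cells in it that are not
  bounded in number by a multiple of \<open>card (hist G)\<close> are the relations \<open>ha \<prec> hb\<close> between siblings, of
  which there are at most \<open>(max_acts G)\<^sup>2\<close> for each node \<open>h\<close> of a player.  This bounds the space.  For the
  time, a traversal of the tree is linear, as the steps at a node are charged to the node and its
  children.  In the belief update, a node of a player is the smaller element of at most
  \<open>2 * max_acts G\<close> relations (its children and siblings), so that collecting \<open>C\<close> is cheap, and
  generating and clearing the relations costs at most a multiple of their number.
\<close>

section \<open>Resource bounds for programs\<close>

text \<open>A Hoare triple for resources: \<open>P\<close> and \<open>Q\<close> bound the occupied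
  cells from above, times add up under composition, and the cap \<open>K\<close> stays fixed because
  taking the maximum with \<open>K\<close> is idempotent. Contents are left unconstrained, so a
  bound covers all stored values.\<close>

definition bounded :: "nat \<Rightarrow> 'a cell set \<Rightarrow> 'a cell set \<Rightarrow> nat \<Rightarrow> ('a, 'r) prog \<Rightarrow> bool" where
  "bounded K P Q n m \<longleftrightarrow> (\<forall>s. occupied s \<subseteq> P \<longrightarrow>
     occupied (snd (run_state m s)) \<subseteq> Q \<and>
     time (snd (run_state m s)) \<le> time s + n \<and>
     peak (snd (run_state m s)) \<le> max (peak s) K)"

lemma boundedD:
  assumes "bounded K P Q n m" "occupied s \<subseteq> P"
  shows "occupied (snd (run_state m s)) \<subseteq> Q"
    and "time (snd (run_state m s)) \<le> time s + n"
    and "peak (snd (run_state m s)) \<le> max (peak s) K"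
  using assms unfolding bounded_def by auto

lemma bounded_weaken:
  assumes "bounded K P Q n m" "P' \<subseteq> P" "Q \<subseteq> Q'" "n \<le> n'"
  shows "bounded K P' Q' n' m"
  unfolding bounded_def
proof (intro allI impI)
  fix s :: "'a machine"
  assume "occupied s \<subseteq> P'"
  then have "occupied s \<subseteq> P" using assms(2) by blast
  from boundedD[OF assms(1) this] assms(3,4)
  show "occupied (snd (run_state m s)) \<subseteq> Q' \<and>
     time (snd (run_state m s)) \<le> time s + n' \<and>
     peak (snd (run_state m s)) \<le> max (peak s) K"
    by auto
qed

lemma bounded_time:
  assumes "bounded K P Q n m" "n \<le> n'"
  shows "bounded K P Q n' m"
  using bounded_weaken[OF assms(1) _ _ assms(2)] by blast

lemmas state_defs = State_Monad.update_def State_Monad.get_def State_Monad.set_def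

lemma bounded_bind:
  assumes m: "bounded K P Q n m" and f: "\<And>x. bounded K Q R n' (f x)"
  shows "bounded K P R (n + n') (State_Monad.bind m f)"
  unfolding bounded_def
proof (intro allI impI)
  fix s :: "'a machine"
  assume s: "occupied s \<subseteq> P"
  obtain x s' where x: "run_state m s = (x, s')" by fastforce
  have 1: "occupied s' \<subseteq> Q" "time s' \<le> time s + n" "peak s' \<le> max (peak s) K"
    using boundedD[OF m s] x by auto
  note 2 = boundedD[OF f 1(1), of x]
  have "run_state (State_Monad.bind m f) s = run_state (f x) s'"
    using x by (simp add: State_Monad.bind_def)
  with 1 2 show "occupied (snd (run_state (State_Monad.bind m f) s)) \<subseteq> R \<and>
     time (snd (run_state (State_Monad.bind m f) s)) \<le> time s + (n + n') \<and>
     peak (snd (run_state (State_Monad.bind m f) s)) \<le> max (peak s) K"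
    by auto
qed

section \<open>Cost of the primitive operations\<close>

lemma bounded_return: "bounded K P P 0 (State_Monad.return x)"
  by (simp add: bounded_def State_Monad.return_def)

lemma bounded_tick: "bounded K P P 1 tick"
  by (simp add: bounded_def tick_def state_defs)

lemma bounded_op: "bounded K P P 1 (op x)"
  by (simp add: bounded_def op_def tick_def state_defs)

lemma bounded_load: "bounded K P P 1 (load c)"
  by (simp add: bounded_def load_def tick_def state_defs)

lemma bounded_occupied_test: "bounded K P P 1 (occupied_test c)"
  by (simp add: bounded_def occupied_test_def tick_def state_defs)

text \<open>Only \<open>mark\<close>, also inside \<open>store\<close>, can raise the peak; the new
  set of occupied cells stays inside \<open>P\<close>.\<close>

lemma bounded_mark:
  assumes "c \<in> P" "finite P" "card P \<le> K"
  shows "bounded K P P 1 (mark c)"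
proof -
  have "card (insert c (occupied s)) \<le> K" if "occupied s \<subseteq> P" for s :: "'a machine"
    using card_mono[OF assms(2), of "insert c (occupied s)"] that assms(1,3) by auto
  then have "max (peak s) (card (insert c (occupied s))) \<le> max (peak s) K"
    if "occupied s \<subseteq> P" for s :: "'a machine"
    using that by (meson max.mono order_refl)
  with assms(1) show ?thesis
    by (simp add: bounded_def mark_def tick_def state_defs)
qed

lemma bounded_store:
  assumes "c \<in> P" "finite P" "card P \<le> K"
  shows "bounded K P P 1 (store c v)"
proof -
  have "bounded K P P 0 (State_Monad.update (\<lambda>s. s\<lparr>content := (content s)(c := v)\<rparr>))"
    by (simp add: bounded_def state_defs)
  from bounded_bind[OF bounded_mark[OF assms] this] show ?thesis
    unfolding store_def by simp
qed

lemma bounded_release: "bounded K P (P - {c}) 1 (release c)"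
  by (auto simp add: bounded_def release_def tick_def state_defs)

lemma bounded_release_keep: "bounded K P P 1 (release c)"
  using bounded_weaken[OF bounded_release] by blast

lemma bounded_add_to:
  assumes "c \<in> P" "finite P" "card P \<le> K"
  shows "bounded K P P 3 (add_to c v)"
  unfolding add_to_def
  \<comment> \<open>The cost is schematic at first: the rules compute it from the program text, here
    \<open>1 + (1 + 1)\<close>, and the last call compares it with the claim. Most later cost proofs
    have this form.\<close>
  by (rule bounded_time, (rule bounded_bind bounded_load bounded_op bounded_store assms)+) simp

text \<open>Adding both costs keeps the computed cost free of maxima, at the price of a larger
  constant.\<close>

lemma bounded_if:
  assumes "b \<Longrightarrow> bounded K P Q n m" "\<not> b \<Longrightarrow> bounded K P Q n' m'"
  shows "bounded K P Q (n + n') (if b then m else m')"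
  using bounded_time[OF assms(1), of "n + n'"] bounded_time[OF assms(2), of "n + n'"] by auto

text \<open>The cost may vary with the element, so that recursive calls can be charged to subtrees
  and loop bodies to information sets of different sizes. Each element pays one more tick, and the
  empty list the last one.\<close>

lemma bounded_foreach_sum:
  assumes "\<And>x. x \<in> set xs \<Longrightarrow> bounded K P P (c x) (f x)"
  shows "bounded K P P (1 + (\<Sum>x\<leftarrow>xs. 1 + c x)) (foreach xs f)"
  using assms
proof (induction xs)
  case Nil
  then show ?case using bounded_tick by simp
next
  case (Cons x xs)
  have "bounded K P P (1 + (c x + (1 + (\<Sum>x\<leftarrow>xs. 1 + c x)))) (foreach (x # xs) f)"
    unfolding foreach.simps using Cons
    by (intro bounded_bind[OF bounded_tick] bounded_bind[of _ _ P]) auto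
  then show ?case by (simp add: ac_simps)
qed

lemma bounded_foreach:
  assumes "\<And>x. x \<in> set xs \<Longrightarrow> bounded K P P n (f x)"
  shows "bounded K P P (1 + length xs * (1 + n)) (foreach xs f)"
  using bounded_foreach_sum[of xs K P "\<lambda>_. n" f] assms by (simp add: sum_list_triv)

lemma length_enum: "finite A \<Longrightarrow> length (enum A) = card A"
  using enum distinct_card by metis

lemma bounded_size_of:
  assumes "finite A"
  shows "bounded K P P (1 + card A * 2) (size_of A)"
  unfolding size_of_def
  by (rule bounded_time, (rule bounded_bind bounded_foreach bounded_tick bounded_return)+)
    (simp add: length_enum assms)

section \<open>Enumerating and releasing stored cells\<close>

lemma run_stored:
  "run_state (stored f) s = (enum {x. f x \<in> occupied s}, s\<lparr>time := time s + 1\<rparr>)"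
  by (simp add: stored_def tick_def state_defs)

text \<open>The enumerated list depends on the state. Distinctness and inclusion in the preimage of
  \<open>P\<close> hold in every admissible state and suffice to bound its length.\<close>

lemma bounded_bind_stored:
  fixes f :: "'b \<Rightarrow> 'a cell"
  assumes fin: "finite {x. f x \<in> P}"
    and g: "\<And>xs. distinct xs \<Longrightarrow> set xs \<subseteq> {x. f x \<in> P} \<Longrightarrow> bounded K P Q n (g xs)"
  shows "bounded K P Q (1 + n) (State_Monad.bind (stored f) g)"
  unfolding bounded_def
proof (intro allI impI)
  fix s :: "'a machine"
  assume s: "occupied s \<subseteq> P"
  have sub: "{x. f x \<in> occupied s} \<subseteq> {x. f x \<in> P}" using s by blast
  note e = enum[OF finite_subset[OF sub fin]]
  have "bounded K P Q n (g (enum {x. f x \<in> occupied s}))"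
    using g e sub by auto
  from boundedD[OF this, of "s\<lparr>time := time s + 1\<rparr>"] s
  show "occupied (snd (run_state (State_Monad.bind (stored f) g) s)) \<subseteq> Q \<and>
     time (snd (run_state (State_Monad.bind (stored f) g) s)) \<le> time s + (1 + n) \<and>
     peak (snd (run_state (State_Monad.bind (stored f) g) s)) \<le> max (peak s) K"
    by (simp add: run_stored State_Monad.bind_def)
qed

lemma bounded_foreach_release:
  "bounded K P (P - f ` set xs) (1 + length xs * 2) (foreach xs (\<lambda>x. release (f x)))"
proof (induction xs arbitrary: P)
  case Nil
  then show ?case using bounded_tick by simp
next
  case (Cons x xs)
  have "bounded K P (P - {f x} - f ` set xs) (1 + (1 + (1 + length xs * 2)))
    (foreach (x # xs) (\<lambda>x. release (f x)))"
    unfolding foreach.simps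
    by (intro bounded_bind[OF bounded_tick] bounded_bind[OF bounded_release] Cons.IH)
  then show ?case by (rule bounded_weaken) auto
qed

lemma bounded_clear:
  fixes f :: "'b \<Rightarrow> 'a cell"
  assumes fin: "finite {x. f x \<in> P}"
  shows "bounded K P (P - range f) (2 + card {x. f x \<in> P} * 2) (clear f)"
  unfolding bounded_def
proof (intro allI impI)
  fix s :: "'a machine"
  assume s: "occupied s \<subseteq> P"
  have sub: "{x. f x \<in> occupied s} \<subseteq> {x. f x \<in> P}" using s by blast
  note fin' = finite_subset[OF sub fin]
  let ?xs = "enum {x. f x \<in> occupied s}"
  have len: "length ?xs \<le> card {x. f x \<in> P}"
    using length_enum[OF fin'] card_mono[OF fin sub] by simp
  have sub2: "occupied s - f ` set ?xs \<subseteq> P - range f"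
    using enum[OF fin'] s by auto
  \<comment> \<open>Taking \<open>occupied s\<close> itself as the precondition, rather than
    \<open>P\<close>, shows that no cell \<open>f x\<close> survives: exactly the occupied ones are
    enumerated.\<close>
  from boundedD[OF bounded_foreach_release[of K "occupied s" f ?xs], of "s\<lparr>time := time s + 1\<rparr>"]
    len sub2
  show "occupied (snd (run_state (clear f) s)) \<subseteq> P - range f \<and>
     time (snd (run_state (clear f) s)) \<le> time s + (2 + card {x. f x \<in> P} * 2) \<and>
     peak (snd (run_state (clear f) s)) \<le> max (peak s) K"
    by (simp add: run_stored clear_def State_Monad.bind_def)
qed

lemma bounded_clear_keep:
  assumes "finite {x. f x \<in> P}" "card {x. f x \<in> P} \<le> n"
  shows "bounded K P P (2 + n * 2) (clear f)"
  by (rule bounded_weaken[OF bounded_clear[OF assms(1)]]) (use assms(2) in auto)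

lemmas bounded_intros = bounded_bind bounded_return bounded_tick bounded_op bounded_load
  bounded_occupied_test bounded_mark bounded_store bounded_release_keep bounded_add_to bounded_if
  bounded_foreach_sum bounded_size_of

lemma bounded_enter:
  assumes "\<And>k. k < frame_size \<Longrightarrow> Frame h k \<in> P" "finite P" "card P \<le> K"
  shows "bounded K P P 33 (enter h)"
  unfolding enter_def
  \<comment> \<open>\<open>33 = 16 * 2 + 1\<close>: a loop tick and a mark for each of the 16 frame
    cells, and the final tick.\<close>
  by (rule bounded_time, (rule bounded_intros | (simp add: assms; fail))+)
    (simp add: frame_size_def sum_list_triv)

lemma bounded_leave: "bounded K P P 33 (leave h)"
  unfolding leave_def
  by (rule bounded_time, (rule bounded_intros)+) (simp add: frame_size_def sum_list_triv)



section \<open>Cells used by the algorithm\<close>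

context finite_game
begin

section \<open>Nodes, children and information sets\<close>

abbreviation player_nodes :: "'a list set" where
  "player_nodes \<equiv> \<Union> (all_infosets G)"

abbreviation subtree :: "'a list \<Rightarrow> 'a list set" where
  "subtree h \<equiv> {g \<in> hist G. take (length h) g = h}"

lemma child_in_hist: "a \<in> children G h \<longleftrightarrow> h @ [a] \<in> hist G"
  by (simp add: children_def)

lemma children_hist: "a \<in> children G h \<Longrightarrow> h \<in> hist G"
  using prefix_closed child_in_hist by blast

lemma infoset_decision:
  assumes "I \<in> all_infosets G" "h \<in> I"
  shows "h \<in> hist G" "children G h \<noteq> {}" "player G h \<noteq> 0" "infoset_of G h = I"
    "children G h = acts G I"
proof -
  from assms(1) obtain j where j: "j \<in> {1, 2}" "I \<in> infosets G j"
    unfolding all_infosets_def by auto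
  have h: "h \<in> decision_nodes G" "player G h = j"
    using infosets_partition[OF j(1)] j(2) assms(2) unfolding partition_on_def by auto
  then show "h \<in> hist G" and ch: "children G h \<noteq> {}"
    unfolding decision_nodes_def leaves_def by auto
  show pl: "player G h \<noteq> 0" using h j by auto
  show "children G h = acts G I" using acts_children j assms(2) by blast
  show "infoset_of G h = I"
    using infoset_of[OF ch pl] h(2) infosets_partition[OF j(1)] j(2) assms(2)
    unfolding partition_on_def disjoint_def by blast
qed

lemma infoset_of_all:
  assumes "children G h \<noteq> {}" "player G h \<noteq> 0"
  shows "infoset_of G h \<in> all_infosets G"
  using infoset_of[OF assms] unfolding all_infosets_def by auto

lemma infosets_finite: "finite (all_infosets G)" "I \<in> all_infosets G \<Longrightarrow> finite I"
proof -
  have sub: "I \<subseteq> hist G" if "I \<in> all_infosets G" for I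
    using infoset_decision(1) that by blast
  then show "I \<in> all_infosets G \<Longrightarrow> finite I"
    using finite_hist finite_subset by blast
  have "all_infosets G \<subseteq> Pow (hist G)" using sub by blast
  then show "finite (all_infosets G)"
    using finite_hist finite_subset finite_Pow_iff by metis
qed

lemma infoset_nonempty: "I \<in> all_infosets G \<Longrightarrow> I \<noteq> {}"
  using infosets_partition[of 1] infosets_partition[of 2]
  unfolding all_infosets_def partition_on_def by auto

lemma finite_acts: "I \<in> all_infosets G \<Longrightarrow> finite (acts G I)"
  using infoset_nonempty infoset_decision(5) finite_children by (metis ex_in_conv)

text \<open>\<open>infoset_of\<close> recovers an information set from each of its nodes, so this
  also covers sets of different players.\<close>

lemma infosets_disjoint:
  "I \<in> all_infosets G \<Longrightarrow> J \<in> all_infosets G \<Longrightarrow> I \<noteq> J \<Longrightarrow> I \<inter> J = {}"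
  using infoset_decision(4) by blast

section \<open>Counting information sets, children and actions by nodes\<close>

lemma sum_infosets_le:
  fixes f :: "'a list \<Rightarrow> nat"
  shows "(\<Sum>I\<in>all_infosets G. \<Sum>h\<in>I. f h) \<le> (\<Sum>h\<in>hist G. f h)"
proof -
  have "(\<Sum>I\<in>all_infosets G. \<Sum>h\<in>I. f h) = sum f player_nodes"
    using infosets_finite infosets_disjoint by (simp add: sum.Union_disjoint)
  also have "\<dots> \<le> (\<Sum>h\<in>hist G. f h)"
    using infoset_decision(1) finite_hist by (intro sum_mono2) auto
  finally show ?thesis .
qed

lemma sum_card_infosets_le: "(\<Sum>I\<in>all_infosets G. card I) \<le> card (hist G)"
  using sum_infosets_le[of "\<lambda>_. 1"] by simp

lemma card_infoset_pos: "I \<in> all_infosets G \<Longrightarrow> 1 \<le> card I"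
  using infoset_nonempty infosets_finite(2) by (simp add: Suc_leI card_gt_0_iff)

lemma card_infosets_le: "card (all_infosets G) \<le> card (hist G)"
proof -
  have "card (all_infosets G) = (\<Sum>I\<in>all_infosets G. 1)" by simp
  also have "\<dots> \<le> (\<Sum>I\<in>all_infosets G. card I)"
    by (rule sum_mono) (rule card_infoset_pos)
  finally show ?thesis using sum_card_infosets_le by linarith
qed

text \<open>Appending the action to the node is injective into the nodes. Work per child, at chance
  nodes too, therefore adds up to a linear amount without a factor
  \<open>max_acts G\<close>.\<close>

lemma sum_card_children_le: "(\<Sum>h\<in>hist G. card (children G h)) \<le> card (hist G)"
proof -
  have "(\<Sum>h\<in>hist G. card (children G h)) = card (Sigma (hist G) (children G))"
    using finite_hist finite_children by (simp add: card_SigmaI)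
  also have "\<dots> = card ((\<lambda>(h, a). h @ [a]) ` Sigma (hist G) (children G))"
    by (rule card_image[symmetric]) (auto simp: inj_on_def)
  also have "\<dots> \<le> card (hist G)"
    by (rule card_mono[OF finite_hist]) (auto simp: child_in_hist)
  finally show ?thesis .
qed

text \<open>An information set has at least one node, and each of its nodes has one child per
  action.\<close>

lemma sum_card_acts_le: "(\<Sum>I\<in>all_infosets G. card (acts G I)) \<le> card (hist G)"
proof -
  have "card (acts G I) \<le> (\<Sum>h\<in>I. card (children G h))" if I: "I \<in> all_infosets G" for I
    using infoset_decision(5)[OF I] card_infoset_pos[OF I] by simp
  then have "(\<Sum>I\<in>all_infosets G. card (acts G I))
      \<le> (\<Sum>I\<in>all_infosets G. \<Sum>h\<in>I. card (children G h))"
    by (rule sum_mono)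
  then show ?thesis
    using sum_infosets_le[of "\<lambda>h. card (children G h)"] sum_card_children_le by linarith
qed

lemma card_acts_le: "I \<in> all_infosets G \<Longrightarrow> card (acts G I) \<le> max_acts G"
  unfolding max_acts_def using infosets_finite(1) by (intro Max_ge) auto

lemma card_children_le: "h \<in> player_nodes \<Longrightarrow> card (children G h) \<le> max_acts G"
  using card_acts_le infoset_decision(5) by auto

text \<open>Avoids the unspecified \<open>Max {}\<close> and later allows terms linear in
  \<open>card (hist G)\<close> to be absorbed into the bound.\<close>

lemma max_acts_pos:
  assumes "all_infosets G \<noteq> {}"
  shows "1 \<le> max_acts G"
proof -
  obtain I h where "I \<in> all_infosets G" "h \<in> I"
    using assms infoset_nonempty by blast
  then have "children G h \<noteq> {}" "card (children G h) \<le> max_acts G"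
    using infoset_decision(2) card_children_le by blast+
  moreover from this have "1 \<le> card (children G h)"
    using finite_children by (simp add: Suc_leI card_gt_0_iff)
  ultimately show ?thesis by linarith
qed

lemma card_hist_pos: "1 \<le> card (hist G)"
  using root finite_hist by (metis One_nat_def Suc_leI card_gt_0_iff empty_iff)

section \<open>Sibling pairs and the set of admissible cells\<close>

definition siblings :: "('a list \<times> 'a \<times> 'a) set" where
  "siblings = (SIGMA g:player_nodes. children G g \<times> children G g)"

lemma finite_player_nodes: "finite player_nodes"
  using infosets_finite by blast

lemma siblings_finite: "finite siblings"
  unfolding siblings_def using finite_player_nodes finite_children by blast

text \<open>Ordered pairs of actions at one node are the source of the square. Only player nodes
  count here, as \<open>max_acts G\<close> does not bound the number of chance outcomes.\<close>

lemma card_siblings_le: "card siblings \<le> card (hist G) * max_acts G ^ 2"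
proof -
  have "card siblings = (\<Sum>g\<in>player_nodes. card (children G g) * card (children G g))"
    unfolding siblings_def using finite_player_nodes finite_children
    by (simp add: card_SigmaI card_cartesian_product)
  also have "\<dots> \<le> (\<Sum>g\<in>player_nodes. max_acts G * max_acts G)"
    using card_children_le by (intro sum_mono mult_le_mono) auto
  also have "\<dots> \<le> card (hist G) * (max_acts G * max_acts G)"
    using card_mono[OF finite_hist, of player_nodes] infoset_decision(1) by auto
  finally show ?thesis by (simp add: power2_eq_square)
qed

text \<open>The cells \<open>InC h\<close> are restricted to \<open>h \<in> J\<close>: clearing them is charged to the current information
  set, so none may be left over from another one.\<close>

primrec used :: "'a list set \<Rightarrow> 'a cell \<Rightarrow> bool" where
  "used J (Strat I a) = (I \<in> all_infosets G \<and> a \<in> acts G I)"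
| "used J (NextStrat I a) = (I \<in> all_infosets G \<and> a \<in> acts G I)"
| "used J (StratSum I a) = (I \<in> all_infosets G \<and> a \<in> acts G I)"
| "used J (Avg I a) = (I \<in> all_infosets G \<and> a \<in> acts G I)"
| "used J (Regret I a) = (I \<in> all_infosets G \<and> a \<in> acts G I)"
| "used J (RegretSum I) = (I \<in> all_infosets G)"
| "used J (S I a) = (I \<in> all_infosets G \<and> a \<in> acts G I)"
| "used J (Belief h) = (h \<in> hist G)"
| "used J (UE h i) = (h \<in> hist G \<and> i \<in> {1, 2})"
| "used J (UBact I a) = (I \<in> all_infosets G \<and> a \<in> acts G I)"
| "used J (UB I) = (I \<in> all_infosets G)"
| "used J (Reach h) = (h \<in> hist G)"
| "used J (ReachI I) = (I \<in> all_infosets G)"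
| "used J (Prec h h') =
    ((\<exists>a\<in>children G h. h' = h @ [a]) \<or> (\<exists>(g, a, b)\<in>siblings. h = g @ [a] \<and> h' = g @ [b]))"
| "used J (Sim h h') = (h \<in> hist G \<and> (\<exists>a\<in>children G h. h' = h @ [a]))"
| "used J (InB h h') = (h \<in> hist G \<and> (\<exists>a\<in>children G h. h' = h @ [a]))"
| "used J (InW h h') = (h \<in> hist G \<and> (\<exists>a\<in>children G h. h' = h @ [a]))"
| "used J (InC h) = (h \<in> J \<and> h \<in> hist G)"
| "used J CardC = True"
| "used J (Arg h i) = (h \<in> hist G \<and> i \<in> {0, 1, 2})"
| "used J (UAcc h i) = (h \<in> hist G \<and> i \<in> {1, 2})"
| "used J (Frame h k) = (h \<in> hist G \<and> k < frame_size)"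
| "used J (Ctrl k) = (k < frame_size)"
| "used J (InNode h) = (h \<in> hist G)"
| "used J (InPlayer h) = (h \<in> hist G)"
| "used J (InInfoset h) = (h \<in> hist G)"
| "used J (InAct I a) = (I \<in> all_infosets G \<and> a \<in> acts G I)"
| "used J (InProb h a) = (h \<in> hist G \<and> a \<in> children G h)"
| "used J (InUtil h i) = (h \<in> hist G \<and> i \<in> {1, 2})"

definition cells :: "'a list set \<Rightarrow> 'a cell set" where
  "cells J = {c. used J c}"

lemma cells_iff [simp]: "c \<in> cells J \<longleftrightarrow> used J c"
  by (simp add: cells_def)

lemma cells_mono: "J \<subseteq> J' \<Longrightarrow> cells J \<subseteq> cells J'"
proof
  fix c assume "J \<subseteq> J'" "c \<in> cells J"
  then show "c \<in> cells J'" by (cases c) auto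
qed

text \<open>The machine thus starts inside every \<open>cells J\<close>, even inside
  \<open>cells {}\<close>.\<close>

lemma input_cells_subset: "input_cells \<subseteq> cells J"
  unfolding input_cells_def
  using infoset_decision(1) by (auto simp: decision_nodes_def leaves_def)

lemma card_Union_list_le:
  assumes "\<forall>X\<in>set Xs. finite X \<and> card X \<le> n"
  shows "finite (\<Union> (set Xs)) \<and> card (\<Union> (set Xs)) \<le> length Xs * n"
  using assms
proof (induction Xs)
  case (Cons X Xs)
  then have "card (X \<union> \<Union> (set Xs)) \<le> n + length Xs * n"
    by (intro order_trans[OF card_Un_le] add_mono) auto
  with Cons show ?case by simp
qed simp

lemma cells_bound:
  assumes "all_infosets G \<noteq> {}"
  shows "finite (cells J) \<and> card (cells J) \<le> 66 * (card (hist G) * max_acts G ^ 2)"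
proof -
  define n where "n = card (hist G) * max_acts G ^ 2"
  have hn: "card (hist G) \<le> n" and n1: "1 \<le> n"
    unfolding n_def using max_acts_pos[OF assms] card_hist_pos by simp_all
  define A where "A = Sigma (all_infosets G) (acts G)"
  define E where "E = Sigma (hist G) (children G)"
  have A: "finite A" "card A \<le> n"
    unfolding A_def using infosets_finite finite_acts sum_card_acts_le hn
    by (auto simp: card_SigmaI)
  have E: "finite E" "card E \<le> n"
    unfolding E_def using finite_hist finite_children sum_card_children_le hn
    by (auto simp: card_SigmaI)
  have F: "finite (all_infosets G)" "card (all_infosets G) \<le> n"
    using infosets_finite card_infosets_le hn by auto
  have Sb: "finite siblings" "card siblings \<le> n"
    using siblings_finite card_siblings_le by (auto simp: n_def)
  \<comment> \<open>65 families of at most \<open>n\<close> cells each: 24 listed singly, 9 with a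
    player index, and 32 for the 16 positions of \<open>Frame\<close> and of \<open>Ctrl\<close>.
    The constant 66 covers them.\<close>
  define Xs where "Xs = [case_prod Strat ` A, case_prod NextStrat ` A, case_prod StratSum ` A,
    case_prod Avg ` A, case_prod Regret ` A, case_prod S ` A, case_prod UBact ` A,
    case_prod InAct ` A, RegretSum ` all_infosets G, UB ` all_infosets G, ReachI ` all_infosets G,
    Belief ` hist G, Reach ` hist G, InC ` hist G, InNode ` hist G, InPlayer ` hist G,
    InInfoset ` hist G, (\<lambda>(h, a). Sim h (h @ [a])) ` E, (\<lambda>(h, a). InB h (h @ [a])) ` E,
    (\<lambda>(h, a). InW h (h @ [a])) ` E, (\<lambda>(h, a). Prec h (h @ [a])) ` E, case_prod InProb ` E,
    (\<lambda>(g, a, b). Prec (g @ [a]) (g @ [b])) ` siblings, {CardC}]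
    @ map (\<lambda>i. (\<lambda>h. UE h i) ` hist G) [1, 2] @ map (\<lambda>i. (\<lambda>h. UAcc h i) ` hist G) [1, 2]
    @ map (\<lambda>i. (\<lambda>h. InUtil h i) ` hist G) [1, 2] @ map (\<lambda>i. (\<lambda>h. Arg h i) ` hist G) [0, 1, 2]
    @ map (\<lambda>k. (\<lambda>h. Frame h k) ` hist G) [0..<frame_size] @ map (\<lambda>k. {Ctrl k}) [0..<frame_size]"
  have le: "finite (f ` X) \<and> card (f ` X) \<le> n" if "finite X" "card X \<le> n"
    for X :: "'b set" and f :: "'b \<Rightarrow> 'a cell"
    using that card_image_le[OF that(1), of f] by auto
  have "\<forall>X\<in>set Xs. finite X \<and> card X \<le> n"
    unfolding Xs_def set_append set_map list.set ball_Un ball_simps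
    using n1 hn by (intro conjI ballI) (simp_all add: le A E F Sb finite_hist)
  from card_Union_list_le[OF this]
  have U: "finite (\<Union> (set Xs))" "card (\<Union> (set Xs)) \<le> length Xs * n"
    by simp_all
  have len: "length Xs \<le> 66"
    by (simp add: Xs_def frame_size_def)
  have "cells J \<subseteq> \<Union> (set Xs)"
  proof
    fix c assume "c \<in> cells J"
    have "\<exists>X\<in>set Xs. c \<in> X"
    \<comment> \<open>\<open>Prec\<close> cells fall into two families, tree edges and sibling
      pairs; for every other cell the constructor determines the kind of family.\<close>
    proof (cases "\<exists>h h'. c = Prec h h'")
      case True
      with \<open>c \<in> cells J\<close> consider h a where "a \<in> children G h" "c = Prec h (h @ [a])"
        | g a b where "(g, a, b) \<in> siblings" "c = Prec (g @ [a]) (g @ [b])"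
        by auto
      then show ?thesis
      proof cases
        case 1
        then have "c \<in> (\<lambda>(h, a). Prec h (h @ [a])) ` E"
          unfolding E_def using children_hist by force
        then show ?thesis by (rule bexI) (simp add: Xs_def)
      next
        case 2
        then have "c \<in> (\<lambda>(g, a, b). Prec (g @ [a]) (g @ [b])) ` siblings"
          by force
        then show ?thesis by (rule bexI) (simp add: Xs_def)
      qed
    next
      case False
      with \<open>c \<in> cells J\<close> show ?thesis
        unfolding Xs_def set_append set_map list.set bex_Un bex_simps
        by (cases c) (simp_all add: image_iff A_def E_def)
    qed
    then show "c \<in> \<Union> (set Xs)" by blast
  qed
  then have "finite (cells J)" "card (cells J) \<le> length Xs * n"
    using finite_subset[OF _ U(1)] card_mono[OF U(1)] U(2) by (blast, meson le_trans)
  moreover have "length Xs * n \<le> 66 * n"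
    using len by simp
  ultimately show ?thesis
    unfolding n_def by linarith
qed


section \<open>A potential for recursions over the tree\<close>

lemma sum_subtree_children:
  assumes "h \<in> hist G"
  shows "(\<Sum>a\<in>children G h. card (subtree (h @ [a]))) + 1 \<le> card (subtree h)"
proof -
  have "(\<Sum>a\<in>children G h. card (subtree (h @ [a])))
      = card (\<Union>a\<in>children G h. subtree (h @ [a]))"
    using finite_hist finite_children
    by (intro card_UN_disjoint[symmetric]) auto
  \<comment> \<open>The subtrees below the children are disjoint and all miss \<open>h\<close>,
    which gives the additional one.\<close>
  also have "\<dots> \<le> card (subtree h - {h})"
  proof (rule card_mono)
    show "finite (subtree h - {h})" using finite_hist by simp
    show "(\<Union>a\<in>children G h. subtree (h @ [a])) \<subseteq> subtree h - {h}"
    proof safe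
      fix a g assume "take (length (h @ [a])) g = h @ [a]"
      from arg_cong[OF this, of "take (length h)"] show "take (length h) g = h"
        by simp
    qed auto
  qed
  also have "\<dots> = card (subtree h) - 1"
    using assms finite_hist by simp
  finally have 1: "(\<Sum>a\<in>children G h. card (subtree (h @ [a]))) \<le> card (subtree h) - 1" .
  have "h \<in> subtree h" "finite (subtree h)" using assms finite_hist by auto
  then have "1 \<le> card (subtree h)" by (metis One_nat_def Suc_leI card_gt_0_iff empty_iff)
  with 1 show ?thesis by linarith
qed

text \<open>The subtracted constant pays for the steps that the parent of \<open>h\<close> spends on \<open>h\<close>.\<close>

definition subtree_time :: "'a list \<Rightarrow> nat" where
  "subtree_time h = 300 * card (subtree h) - 100"

text \<open>Adding 100 to the share of a child gives 300 times the size of its subtree, and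
  \<open>h\<close> itself contributes \<open>300 - 100 = 200\<close>.\<close>

lemma subtree_time_rec:
  assumes "h \<in> hist G"
  shows "(\<Sum>a\<in>children G h. subtree_time (h @ [a])) + 100 * card (children G h) + 200
    \<le> subtree_time h"
proof -
  \<comment> \<open>Subtrees are nonempty, so the truncated subtraction in
    \<open>subtree_time\<close> is exact.\<close>
  have pos: "1 \<le> card (subtree g)" if "g \<in> hist G" for g
    using sum_subtree_children[OF that] by linarith
  have "(\<Sum>a\<in>children G h. subtree_time (h @ [a])) + 100 * card (children G h)
      = (\<Sum>a\<in>children G h. subtree_time (h @ [a]) + 100)"
    by (simp add: sum.distrib)
  also have "\<dots> = (\<Sum>a\<in>children G h. 300 * card (subtree (h @ [a])))"
    using pos child_in_hist by (intro sum.cong) (force simp: subtree_time_def)+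
  also have "\<dots> = 300 * (\<Sum>a\<in>children G h. card (subtree (h @ [a])))"
    by (simp add: sum_distrib_left)
  finally show ?thesis
    using sum_subtree_children[OF assms] unfolding subtree_time_def by linarith
qed

lemma set_enum: "finite A \<Longrightarrow> set (enum A) = A"
  using enum by blast

lemma sum_list_enum: "finite A \<Longrightarrow> (\<Sum>x\<leftarrow>enum A. f x) = (\<Sum>x\<in>A. f x)"
  by (metis enum sum_list_distinct_conv_sum_set)

lemmas enum_simps = set_enum length_enum sum_list_enum finite_children finite_acts infosets_finite
  sum.distrib sum_Suc


section \<open>Resource bounds for the algorithm\<close>

context
  assumes nonempty: "all_infosets G \<noteq> {}"
begin

text \<open>The peak is capped by \<open>cells UNIV\<close> for all \<open>J\<close> alike, so that
  bounds for different \<open>J\<close> compose.\<close>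

abbreviation bounded_on :: "'a list set \<Rightarrow> nat \<Rightarrow> ('a, 'r) prog \<Rightarrow> bool" where
  "bounded_on J \<equiv> bounded (card (cells UNIV)) (cells J) (cells J)"

lemma finite_cells [simp]: "finite (cells J)"
  using cells_bound[OF nonempty] by blast

lemma card_cells_le [simp]: "card (cells J) \<le> card (cells UNIV)"
  by (rule card_mono) (auto intro: cells_mono[THEN subsetD])

lemma bounded_enter_on: "h \<in> hist G \<Longrightarrow> bounded_on J 33 (enter h)"
  by (rule bounded_enter) auto

lemmas on_intros = bounded_enter_on bounded_leave bounded_intros

section \<open>Regret matching, traversal and reach probabilities\<close>

lemma bounded_update_next_strategy:
  assumes "I \<in> all_infosets G"
  shows "bounded_on J (20 * card (acts G I) + 20) (update_next_strategy I)"
  unfolding update_next_strategy_def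
  by (rule bounded_time, (rule on_intros | (simp add: assms enum_simps; fail))+)

text \<open>The steps at \<open>h\<close> itself cost at most 200 plus 100 per child, which is the
  slack in \<open>subtree_time_rec\<close>; the recursive calls use up the shares of the
  children.\<close>

lemma bounded_traverse: "h \<in> hist G \<Longrightarrow> bounded_on J (subtree_time h) (traverse h r)"
proof (induction "card {g \<in> hist G. length g > length h}" arbitrary: h r rule: less_induct)
  case less
  note h = \<open>h \<in> hist G\<close>
  have IH: "bounded_on J (subtree_time (h @ [a])) (traverse (h @ [a]) r)"
    if "a \<in> children G h" for a r
    using that child_measure by (intro less.hyps) (auto simp: child_in_hist)
  note rec = subtree_time_rec[OF h]
  \<comment> \<open>The cases are equations with truth values, so that unfolding them resolves the
    conditionals of the program.\<close>
  consider (leaf) "(children G h = {}) = True"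
    | (chance) "(children G h = {}) = False" "(player G h = 0) = True"
    | (decision) "(children G h = {}) = False" "(player G h = 0) = False"
    by blast
  then show ?case
  proof cases
    case leaf
    show ?thesis
      unfolding traverse.simps[of h r] leaf if_True
      by (rule bounded_time, (rule on_intros | (simp add: h; fail))+) (use rec in simp)
  next
    case chance
    show ?thesis
      unfolding traverse.simps[of h r] chance if_True if_False
      by (rule bounded_time, (rule IH on_intros
            | (simp add: h enum_simps child_in_hist; fail))+)
        (use rec in \<open>simp add: enum_simps\<close>)
  next
    case decision
    have I: "infoset_of G h \<in> all_infosets G" "acts G (infoset_of G h) = children G h"
      "player G h = 1 \<or> player G h = 2"
      using decision infoset_of_all acts_infoset_of infoset_of(3) by auto
    note U = bounded_update_next_strategy[OF I(1), of J, unfolded I(2)]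
    show ?thesis
      unfolding traverse.simps[of h r] decision if_False Let_def I(2)
      by (rule bounded_time, (rule IH U on_intros
            | (use I in \<open>simp add: h enum_simps child_in_hist; fail\<close>))+)
        (use rec in \<open>simp add: enum_simps\<close>)
  qed
qed

lemma bounded_reach_below: "h \<in> hist G \<Longrightarrow> bounded_on J (subtree_time h) (reach_below sg h)"
proof (induction "card {g \<in> hist G. length g > length h}" arbitrary: h rule: less_induct)
  case less
  note h = \<open>h \<in> hist G\<close>
  have IH: "bounded_on J (subtree_time (h @ [a])) (reach_below sg (h @ [a]))"
    if "a \<in> children G h" for a
    using that child_measure by (intro less.hyps) (auto simp: child_in_hist)
  show ?case
    unfolding reach_below.simps[of sg h]
    by (rule bounded_time, (rule IH on_intros
          | (simp add: h enum_simps child_in_hist; fail))+)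
      (use subtree_time_rec[OF h] in \<open>simp add: enum_simps\<close>)
qed

section \<open>Generating the relations of the belief update\<close>

definition size_bound :: nat where
  "size_bound = card (hist G) * max_acts G ^ 2"

lemma max_acts_facts: "1 \<le> max_acts G" "max_acts G \<le> max_acts G ^ 2" "1 \<le> max_acts G ^ 2"
  using max_acts_pos[OF nonempty] by (auto simp: power2_eq_square)

lemma card_hist_le: "card (hist G) \<le> size_bound"
  unfolding size_bound_def using max_acts_facts(3) by simp

text \<open>The set has the shape to which \<open>used\<close> reduces for the cells
  \<open>InB h\<close> and \<open>InW h\<close>.\<close>

lemma finite_child_set: "finite {h'. h \<in> hist G \<and> (\<exists>a\<in>children G h. h' = h @ [a])}"
  by (rule finite_subset[of _ "(\<lambda>a. h @ [a]) ` children G h"]) (auto simp: finite_children)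

lemma card_child_set_le:
  "card {h'. h \<in> hist G \<and> (\<exists>a\<in>children G h. h' = h @ [a])} \<le> card (children G h)"
proof -
  have "card {h'. h \<in> hist G \<and> (\<exists>a\<in>children G h. h' = h @ [a])}
      \<le> card ((\<lambda>a. h @ [a]) ` children G h)"
    by (rule card_mono) (auto simp: finite_children)
  then show ?thesis
    using card_image_le[OF finite_children, of "\<lambda>a. h @ [a]" h] by linarith
qed

lemma foreach_pairs:
  assumes "\<And>h1 h2. h1 \<in> set B \<Longrightarrow> h2 \<in> set W \<Longrightarrow> Prec h1 h2 \<in> cells J"
    and "length B \<le> n" "length W \<le> n"
  shows "bounded_on J (1 + n * (2 + n * 2)) (foreach B (\<lambda>h1. foreach W (\<lambda>h2. mark (Prec h1 h2))))"
proof -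
  have "bounded_on J (1 + length B * (1 + (1 + length W * (1 + 1))))
      (foreach B (\<lambda>h1. foreach W (\<lambda>h2. mark (Prec h1 h2))))"
    using assms(1) by (intro bounded_foreach bounded_mark) auto
  moreover have "length B * (1 + (1 + length W * (1 + 1))) \<le> n * (2 + n * 2)"
    using assms(2,3) by (intro mult_le_mono) auto
  ultimately show ?thesis
    by (elim bounded_time) simp
qed

text \<open>The loop body at one node. \<open>B\<close> and \<open>W\<close> consist of children of
  \<open>h\<close>, so there are at most \<open>max_acts G ^ 2\<close> pairs; lower-order terms are
  absorbed because \<open>1 \<le> max_acts G\<close>.\<close>

lemma bounded_relations_at:
  assumes I: "I \<in> all_infosets G" and h: "h \<in> I"
  shows "bounded_on J (40 * max_acts G ^ 2) (do {
       foreach (enum (acts G I)) (\<lambda>a. do {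
         p \<leftarrow> load (sg I a);
         tick;
         if p > 0 then do { mark (Sim h (h @ [a])); mark (InB h (h @ [a])) }
         else do { mark (Prec h (h @ [a])); mark (InW h (h @ [a])) } });
       B \<leftarrow> stored (InB h);
       W \<leftarrow> stored (InW h);
       foreach B (\<lambda>h1. foreach W (\<lambda>h2. mark (Prec h1 h2)));
       clear (InB h);
       clear (InW h) })"
proof -
  have hh: "h \<in> hist G" and acts: "acts G I = children G h"
    using infoset_decision[OF I h] by auto
  let ?k = "card (children G h)"
  have k: "?k \<le> max_acts G" using card_children_le I h by blast
  have kk: "?k * ?k \<le> max_acts G ^ 2" unfolding power2_eq_square using k by (intro mult_le_mono)
  have len: "length xs \<le> ?k"
    if "distinct xs" "set xs \<subseteq> {h'. h \<in> hist G \<and> (\<exists>a\<in>children G h. h' = h @ [a])}"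
    for xs :: "'a list list"
    using card_mono[OF finite_child_set that(2)] card_child_set_le[of h] distinct_card[OF that(1)]
    by linarith
  \<comment> \<open>Two children of the player node \<open>h\<close> form a sibling pair, so a
    relation between them is an admissible cell.\<close>
  have sib: "Prec h1 h2 \<in> cells J"
    if hs: "h1 \<in> {h'. h \<in> hist G \<and> (\<exists>a\<in>children G h. h' = h @ [a])}"
      "h2 \<in> {h'. h \<in> hist G \<and> (\<exists>a\<in>children G h. h' = h @ [a])}" for h1 h2
  proof -
    obtain a b where "a \<in> children G h" "h1 = h @ [a]" "b \<in> children G h" "h2 = h @ [b]"
      using hs by blast
    moreover from this have "(h, a, b) \<in> siblings"
      unfolding siblings_def using I h by blast
    ultimately have "used J (Prec h1 h2)"
      unfolding used.simps by blast
    then show ?thesis by simp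
  qed
  have clr: "bounded_on J (2 + ?k * 2) (clear (InB h))" "bounded_on J (2 + ?k * 2) (clear (InW h))"
    by (rule bounded_clear_keep; simp add: finite_child_set card_child_set_le)+
  have rest: "bounded_on J (1 + (1 + ((1 + ?k * (2 + ?k * 2)) + ((2 + ?k * 2) + (2 + ?k * 2))))) (do {
       B \<leftarrow> stored (InB h);
       W \<leftarrow> stored (InW h);
       foreach B (\<lambda>h1. foreach W (\<lambda>h2. mark (Prec h1 h2)));
       clear (InB h);
       clear (InW h) })"
  proof (intro bounded_bind_stored)
    fix B W :: "'a list list"
    assume B: "distinct B" "set B \<subseteq> {x. InB h x \<in> cells J}"
      and W: "distinct W" "set W \<subseteq> {x. InW h x \<in> cells J}"
    show "bounded_on J ((1 + ?k * (2 + ?k * 2)) + ((2 + ?k * 2) + (2 + ?k * 2)))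
      (do { foreach B (\<lambda>h1. foreach W (\<lambda>h2. mark (Prec h1 h2))); clear (InB h); clear (InW h) })"
    proof (intro bounded_bind[OF foreach_pairs] bounded_bind[OF clr(1)] clr(2))
      show "Prec h1 h2 \<in> cells J" if "h1 \<in> set B" "h2 \<in> set W" for h1 h2
        using B(2) W(2) that by (intro sib) auto
      show "length B \<le> ?k" using B by (intro len) auto
      show "length W \<le> ?k" using W by (intro len) auto
    qed
  qed (simp_all add: finite_child_set)
  show ?thesis
    unfolding acts
    by (rule bounded_time, (rule rest on_intros
          | (simp add: enum_simps hh child_in_hist; fail))+)
      (use k kk max_acts_facts in \<open>simp add: enum_simps algebra_simps\<close>)
qed

lemma bounded_add_relations: "bounded_on J (50 * size_bound + 10) (add_relations sg)"
proof -
  let ?C = "{h \<in> decision_nodes G. player G h = 0}"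
  have C: "finite ?C" "?C \<subseteq> hist G"
    using finite_hist by (auto simp: decision_nodes_def)
  have "(\<Sum>h\<in>?C. card (children G h)) \<le> card (hist G)"
    using sum_mono2[OF finite_hist C(2), of "\<lambda>h. card (children G h)"] sum_card_children_le
    by simp
  moreover have "card ?C \<le> card (hist G)"
    using card_mono[OF finite_hist C(2)] .
  \<comment> \<open>Information sets are disjoint, so the cost per node is paid at most once for
    each node of the tree.\<close>
  moreover have "(\<Sum>I\<in>all_infosets G. card I * (40 * max_acts G ^ 2)) \<le> 40 * size_bound"
    using mult_le_mono1[OF sum_card_infosets_le, of "40 * max_acts G ^ 2"]
    by (simp add: size_bound_def sum_distrib_right[symmetric] ac_simps)
  moreover have dec: "finite (decision_nodes G)" "h \<in> decision_nodes G \<Longrightarrow> h \<in> hist G" for h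
    using finite_hist by (simp_all add: decision_nodes_def)
  moreover note card_hist_le card_infosets_le sum_card_infosets_le
  ultimately show ?thesis
    unfolding add_relations_def
    by - (rule bounded_time, (rule bounded_relations_at on_intros
          | (simp add: dec enum_simps child_in_hist; fail))+)
qed

section \<open>Collecting \<open>C\<close> and computing the beliefs\<close>

lemma prec_at:
  assumes "h \<in> player_nodes"
  shows "finite {h'. Prec h h' \<in> cells J}" "card {h'. Prec h h' \<in> cells J} \<le> 2 * max_acts G"
proof -
  let ?f = "\<lambda>g. (\<lambda>a. g @ [a]) ` children G g"
  \<comment> \<open>\<open>butlast h\<close> is the parent. Sibling relations arise only below a
    player node, where \<open>max_acts G\<close> bounds the children. At the root,
    \<open>butlast [] = []\<close> merely repeats the children.\<close>
  let ?S = "if butlast h \<in> player_nodes then ?f (butlast h) else {}"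
  have sub: "{h'. Prec h h' \<in> cells J} \<subseteq> ?f h \<union> ?S"
    by (auto simp: siblings_def)
  have fin: "finite (?f h \<union> ?S)"
    by (simp add: finite_children)
  have c: "card (?f g) \<le> max_acts G" if "g \<in> player_nodes" for g
    using card_image_le[OF finite_children, of "\<lambda>a. g @ [a]" g] card_children_le[OF that]
    by linarith
  have "card ?S \<le> max_acts G"
    using c[of "butlast h"] by simp
  with c[OF assms] card_Un_le[of "?f h" ?S] have "card (?f h \<union> ?S) \<le> 2 * max_acts G"
    by linarith
  with card_mono[OF fin sub] show "card {h'. Prec h h' \<in> cells J} \<le> 2 * max_acts G"
    by linarith
  show "finite {h'. Prec h h' \<in> cells J}"
    using finite_subset[OF sub fin] .
qed

lemma bounded_collect_C:
  assumes I: "I \<in> all_infosets G"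
  shows "bounded_on I (1 + 20 * (card I * max_acts G)) (collect_C I)"
proof -
  have "bounded_on I (1 + (1 + (2 * max_acts G) * (1 + (1 + 1)))) (do {
     hs \<leftarrow> stored (Prec h1);
     foreach hs (\<lambda>h2. do {
       tick;
       if h2 \<in> I \<and> h2 \<noteq> h1 then mark (InC h1) else State_Monad.return () }) })"
    if h1: "h1 \<in> I" for h1
  proof (intro bounded_bind_stored prec_at)
    show "h1 \<in> player_nodes" using h1 I by blast
    fix hs :: "'a list list"
    assume hs: "distinct hs" "set hs \<subseteq> {x. Prec h1 x \<in> cells I}"
    have "length hs \<le> 2 * max_acts G"
      using card_mono[OF prec_at(1) hs(2)] prec_at(2)[of h1 I] distinct_card[OF hs(1)]
        h1 I by fastforce
    moreover have "h1 \<in> hist G" using infoset_decision(1)[OF I h1] .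
    ultimately show "bounded_on I (1 + 2 * max_acts G * (1 + (1 + 1))) (foreach hs (\<lambda>h2. do {
       tick;
       if h2 \<in> I \<and> h2 \<noteq> h1 then mark (InC h1) else State_Monad.return () }))"
      using h1
      by - (rule bounded_time, (rule bounded_foreach bounded_intros | (simp; fail))+)
  qed
  then have "bounded_on I (1 + length (enum I) * (1 + (1 + (1 + (2 * max_acts G) * (1 + (1 + 1))))))
      (collect_C I)"
    unfolding collect_C_def using I by (intro bounded_foreach) (simp add: enum_simps)
  moreover have "card I * (1 + (1 + (1 + (2 * max_acts G) * (1 + (1 + 1)))))
      \<le> card I * (20 * max_acts G)"
    using max_acts_facts(1) by (intro mult_le_mono) auto
  ultimately show ?thesis
    using I by (elim bounded_time) (simp add: enum_simps)
qed

text \<open>Only the \<open>InC\<close> cells depend on the index of \<open>cells\<close>, so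
  removing them from \<open>cells I\<close> leaves a subset of \<open>cells {}\<close>, and the next
  information set starts without marks.\<close>

lemma bounded_clear_InC:
  assumes I: "I \<in> all_infosets G"
  shows "bounded (card (cells UNIV)) (cells I) (cells {}) (2 + card I * 2) (clear InC)"
proof -
  have eq: "{h. InC h \<in> cells I} = I"
    using infoset_decision(1)[OF I] by auto
  have "cells I - range InC \<subseteq> cells {}"
  proof
    fix c assume "c \<in> cells I - range InC"
    then show "c \<in> cells {}" by (cases c) auto
  qed
  with bounded_clear[of InC "cells I"] show ?thesis
    unfolding eq using infosets_finite(2)[OF I] by (blast intro: bounded_weaken)
qed

lemma bounded_widen:
  assumes "bounded K (cells I) Q n m"
  shows "bounded K (cells {}) Q n m"
  by (rule bounded_weaken[OF assms cells_mono]) auto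

lemma bounded_beliefs_at:
  assumes I: "I \<in> all_infosets G"
  shows "bounded_on {} (100 * (card I * max_acts G)) (beliefs_at I)"
proof -
  have mem: "h \<in> hist G" if "h \<in> I" for h
    using infoset_decision(1)[OF I that] .
  \<comment> \<open>Naming the product opaquely keeps the cost comparison linear.\<close>
  obtain m where m: "m = card I * max_acts G" by blast
  have le: "1 \<le> card I" "card I \<le> m"
    using card_infoset_pos[OF I] max_acts_facts(1) by (auto simp: m)
  have C: "bounded (card (cells UNIV)) (cells {}) (cells {})
    (20 + 40 * m) (do {
       collect_C I;
       store CardC 0;
       foreach (enum I) (\<lambda>h. do {
         b \<leftarrow> occupied_test (InC h);
         if b then add_to CardC 1 else State_Monad.return () });
       n \<leftarrow> load CardC;
       foreach (enum I) (\<lambda>h. do {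
         b \<leftarrow> occupied_test (InC h);
         if b then do { m \<leftarrow> op (1 / n); store (Belief h) m } else store (Belief h) 0 });
       clear InC;
       release CardC })"
    \<comment> \<open>The branch starts without \<open>InC\<close> cells, works in
      \<open>cells I\<close>, and returns to \<open>cells {}\<close> at
      \<open>clear InC\<close>.\<close>
    by (rule bounded_widen[where I = I], rule bounded_time,
        (rule bounded_collect_C[OF I, folded m] bounded_clear_InC[OF I] on_intros
          | (simp add: I enum_simps mem; fail))+)
      (use le in \<open>simp add: I enum_simps\<close>)
  show ?thesis
    unfolding beliefs_at_def m[symmetric]
    by (rule bounded_time, (rule C on_intros | (simp add: I enum_simps mem; fail))+)
      (use le in \<open>simp add: I enum_simps\<close>)
qed

text \<open>Whatever strategy produced them, the stored relations are tree edges or sibling pairs,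
  at most \<open>size_bound\<close> of each kind.\<close>

lemma bounded_clear_prec: "bounded_on J (2 + (2 * size_bound) * 2) (clear (\<lambda>(h, h'). Prec h h'))"
proof (rule bounded_clear_keep)
  let ?E = "(\<lambda>(h, a). (h, h @ [a])) ` Sigma (hist G) (children G)"
  let ?S = "(\<lambda>(g, a, b). (g @ [a], g @ [b])) ` siblings"
  have sub: "{x. (case x of (h, h') \<Rightarrow> Prec h h') \<in> cells J} \<subseteq> ?E \<union> ?S"
    using children_hist by (force simp: image_iff)
  have fE: "finite (Sigma (hist G) (children G))"
    using finite_hist finite_children by simp
  then have fin: "finite (?E \<union> ?S)"
    using siblings_finite by simp
  then show "finite {x. (case x of (h, h') \<Rightarrow> Prec h h') \<in> cells J}"
    using sub by (rule finite_subset[rotated])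
  have "card ?E \<le> card (Sigma (hist G) (children G))"
    using fE by (rule card_image_le)
  also have "\<dots> \<le> size_bound"
    using finite_hist finite_children sum_card_children_le card_hist_le
    by (simp add: card_SigmaI)
  finally have "card ?E \<le> size_bound" .
  moreover have "card ?S \<le> size_bound"
    using card_image_le[OF siblings_finite] card_siblings_le
    unfolding size_bound_def by (rule order_trans)
  ultimately have "card (?E \<union> ?S) \<le> 2 * size_bound"
    using card_Un_le[of ?E ?S] by linarith
  then show "card {x. (case x of (h, h') \<Rightarrow> Prec h h') \<in> cells J} \<le> 2 * size_bound"
    using card_mono[OF fin sub] by linarith
qed

lemma bounded_clear_sim: "bounded_on J (2 + size_bound * 2) (clear (\<lambda>(h, h'). Sim h h'))"
proof (rule bounded_clear_keep)
  let ?E = "(\<lambda>(h, a). (h, h @ [a])) ` Sigma (hist G) (children G)"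
  have sub: "{x. (case x of (h, h') \<Rightarrow> Sim h h') \<in> cells J} \<subseteq> ?E"
    by (force simp: image_iff)
  have fE: "finite (Sigma (hist G) (children G))"
    using finite_hist finite_children by simp
  then have fin: "finite ?E"
    by simp
  then show "finite {x. (case x of (h, h') \<Rightarrow> Sim h h') \<in> cells J}"
    using sub by (rule finite_subset[rotated])
  have "card ?E \<le> card (Sigma (hist G) (children G))"
    using fE by (rule card_image_le)
  also have "\<dots> \<le> size_bound"
    using finite_hist finite_children sum_card_children_le card_hist_le
    by (simp add: card_SigmaI)
  finally show "card {x. (case x of (h, h') \<Rightarrow> Sim h h') \<in> cells J} \<le> size_bound"
    using card_mono[OF fin sub] by linarith
qed

section \<open>Total cost of a belief update, a timestep and the whole run\<close>

lemma subtree_time_root: "subtree_time [] \<le> 300 * card (hist G)"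
  by (simp add: subtree_time_def)

lemma size_bound_pos: "1 \<le> size_bound"
  using card_hist_le card_hist_pos by linarith

lemmas size_bounds = card_hist_le card_infosets_le sum_card_infosets_le sum_card_acts_le
  subtree_time_root size_bound_pos

lemma sum_beliefs_le: "(\<Sum>I\<in>all_infosets G. card I * max_acts G) \<le> size_bound"
proof -
  have "(\<Sum>I\<in>all_infosets G. card I * max_acts G) \<le> card (hist G) * max_acts G"
    using sum_card_infosets_le by (simp add: sum_distrib_right[symmetric])
  also have "\<dots> \<le> size_bound"
    unfolding size_bound_def using max_acts_facts(2) by simp
  finally show ?thesis .
qed

lemma bounded_update_beliefs: "bounded_on {} (600 * size_bound) (update_beliefs sg)"
  unfolding update_beliefs_def compute_reach_def
  by (rule bounded_time, (rule bounded_clear_prec bounded_clear_sim bounded_add_relations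
        bounded_reach_below bounded_beliefs_at on_intros | (simp add: enum_simps root; fail))+)
    (use size_bounds sum_beliefs_le in \<open>simp add: enum_simps sum_distrib_left[symmetric]\<close>)

lemma bounded_initialize: "bounded_on {} (200 * size_bound) initialize"
  unfolding initialize_def
  by (rule bounded_time, (rule on_intros
        | (simp add: enum_simps infoset_decision(1); fail))+)
    (use size_bounds in
      \<open>simp add: enum_simps frame_size_def sum_list_triv sum_distrib_left[symmetric]\<close>)

lemma bounded_timestep: "bounded_on {} (1000 * size_bound) timestep"
  unfolding timestep_def
  by (rule bounded_time, (rule bounded_traverse bounded_update_beliefs on_intros
        | (simp add: enum_simps root; fail))+)
    (use size_bounds in \<open>simp add: enum_simps sum_distrib_right[symmetric]\<close>)

lemma bounded_pbe_cfr:
  assumes "T \<ge> 1"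
  shows "bounded_on {} (3000 * (T * size_bound)) (pbe_cfr T)"
proof -
  have "bounded_on {} (1000 * size_bound + T * (1 + 1000 * size_bound)) (pbe_cfr T)"
    unfolding pbe_cfr_def
    by (rule bounded_time, (rule bounded_initialize bounded_timestep bounded_update_beliefs on_intros
          | (simp add: enum_simps; fail))+)
      (use size_bounds in
        \<open>simp add: enum_simps sum_list_triv algebra_simps sum_distrib_left[symmetric]\<close>)
  moreover have "T * (1 + 1000 * size_bound) \<le> T * (1001 * size_bound)"
    using size_bound_pos by (intro mult_le_mono) auto
  \<comment> \<open>Since \<open>T \<ge> 1\<close>, the work done only once (initialization,
    averaging, final belief update) is absorbed by the factor \<open>T\<close>.\<close>
  moreover have "size_bound \<le> T * size_bound"
    using assms by simp
  ultimately show ?thesis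
    by (elim bounded_time) linarith
qed

lemma pbe_cfr_space_le: "T \<ge> 1 \<Longrightarrow> pbe_cfr_space T \<le> 66 * size_bound"
  \<comment> \<open>The peak starts at the size of the input, which itself lies in
    \<open>cells UNIV\<close>.\<close>
  using boundedD(3)[OF bounded_pbe_cfr, of T input_machine] cells_bound[OF nonempty, of UNIV]
    card_mono[OF finite_cells input_cells_subset, of UNIV] input_cells_subset[of "{}"]
  by (simp add: pbe_cfr_space_def input_machine_def size_bound_def)

lemma pbe_cfr_time_le: "T \<ge> 1 \<Longrightarrow> pbe_cfr_time T \<le> 3000 * (T * size_bound)"
  using boundedD(2)[OF bounded_pbe_cfr, of T input_machine] input_cells_subset[of "{}"]
  by (simp add: pbe_cfr_time_def input_machine_def)

end

end

theorem theorem4p1: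
  shows "(\<exists>c::real. \<forall>(G :: 'a game) (T :: nat).
            finite_game G \<and> all_infosets G \<noteq> {} \<and> T \<ge> 1 \<longrightarrow>
            real (finite_game.pbe_cfr_space G T)
              \<le> c * (real (card (hist G)) * real (max_acts G) ^ 2))
       \<and> (\<exists>c::real. \<forall>(G :: 'a game) (T :: nat).
            finite_game G \<and> all_infosets G \<noteq> {} \<and> T \<ge> 1 \<longrightarrow>
            real (finite_game.pbe_cfr_time G T)
              \<le> c * (real T * real (card (hist G)) * real (max_acts G) ^ 2))"
\<comment> \<open>The two constants stay open here, before \<open>G\<close> and \<open>T\<close> are
  fixed; the \<open>show\<close> steps instantiate them with 66 and 3000.\<close>
proof (intro conjI exI allI impI)
  fix G :: "'a game" and T :: nat
  assume asm: "finite_game G \<and> all_infosets G \<noteq> {} \<and> T \<ge> 1"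
  then interpret finite_game G by simp
  have "real (pbe_cfr_space T) \<le> real (66 * size_bound)"
    using asm pbe_cfr_space_le by (intro of_nat_mono) simp
  then show "real (pbe_cfr_space T) \<le> 66 * (real (card (hist G)) * real (max_acts G) ^ 2)"
    using asm by (simp add: size_bound_def)
  have "real (pbe_cfr_time T) \<le> real (3000 * (T * size_bound))"
    using asm pbe_cfr_time_le by (intro of_nat_mono) simp
  then show "real (pbe_cfr_time T)
      \<le> 3000 * (real T * real (card (hist G)) * real (max_acts G) ^ 2)"
    using asm by (simp add: size_bound_def mult.assoc)
qed

end
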